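(* Let $\beta_1,\beta_2,\beta_3\in\mathbb R$ be arbitrary and let $\beta_4\in\mathbb R$ with $|\beta_4|<1$. For $\mathbf W\in\mathcal W_3$ let $$T(\mathbf W)=\sum_{a=1}^3\beta_a\int_{[0,1]^2}W_a(x,y)\,dx\,dy+\beta_4\int_{[0,1]^3}W_1(x,y)W_2(y,z)W_3(z,x)\,dx\,dy\,dz.$$ Then the variational problem $\sup_{\widetilde{\mathbf W}\in\widetilde{\mathcal W}_3}\{T(\mathbf W)-\frac12\mathcal I(\mathbf W)\}$ has a unique maximizer. Consequently, this maximizer is a constant $3$-colored probability graphon.
   Context: $\Delta_3=\{\mu\in[0,1]^3:\mu_1+\mu_2+\mu_3=1\}$. A $3$-colored probability graphon is a measurable symmetric map $\mathbf W=(W_1,W_2,W_3):[0,1]^2\to\Delta_3$; $\mathcal W_3$ is the set of these. For bounded measurable $U$ on $[0,1]^2$, $\|U\|_\square=\sup_{S,T\subset[0,1]}|\int_{S\times T}U|$; $\|\mathbf U\|_\square=\sum_a\|U_a\|_\square$; $\delta_\square(\mathbf U,\mathbf W)=\inf_\phi\|\mathbf U-\mathbf W^\phi\|_\square$ over measure-preserving bijections $\phi$ of $[0,1]$, $\mathbf W^\phi(x,y)=\mathbf W(\phi(x),\phi(y))$. $\widetilde{\mathcal W}_3$ is the quotient of $\mathcal W_3$ by $\delta_\square=0$; $T$ and $\mathcal I$ depend only on the class. $\mathcal I(\mathbf W)=\sum_{a=1}^3\int_{[0,1]^2}W_a\log W_a\,dx\,dy$, $0\log0=0$. Constant means $\mathbf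 W(x,y)=\mu$ for almost every $(x,y)$, for some fixed $\mu\in\Delta_3$. *)

theory Defs
  imports "HOL-Analysis.Analysis"
begin

text \<open>
  Colors are the elements of the numeral type \<^typ>\<open>3\<close> (whose elements are 1, 2 and 3 = 0), so a
  point of the simplex is a vector in \<^typ>\<open>real^3\<close>. Measurable means Lebesgue measurable.
\<close>

definition simplex3 :: "(real^3) set" where
  "simplex3 = {\<mu>. (\<forall>a. 0 \<le> \<mu> $ a \<and> \<mu> $ a \<le> 1) \<and> \<mu> $ 1 + \<mu> $ 2 + \<mu> $ 3 = 1}"

abbreviation unit_iv :: "real set" where
  "unit_iv \<equiv> {0..1}"

text \<open>
  A graphon is a total HOL function of which only the values on the unit square matter:
  values outside it enter neither the conditions below nor any integral.
\<close>

definition graphons3 :: "(real \<times> real \<Rightarrow> real^3) set" where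
  "graphons3 = {W. W \<in> borel_measurable (lebesgue_on (unit_iv \<times> unit_iv)) \<and>
     (\<forall>p \<in> unit_iv \<times> unit_iv. W p \<in> simplex3) \<and>
     (\<forall>x \<in> unit_iv. \<forall>y \<in> unit_iv. W (x, y) = W (y, x))}"

definition constant_graphon3 :: "(real \<times> real \<Rightarrow> real^3) \<Rightarrow> bool" where
  "constant_graphon3 W \<longleftrightarrow>
     (\<exists>\<mu> \<in> simplex3. AE p in lebesgue_on (unit_iv \<times> unit_iv). W p = \<mu>)"

definition cut_norm :: "(real \<times> real \<Rightarrow> real) \<Rightarrow> real" where
  "cut_norm U =
     (SUP (S, T) \<in> {(S, T). S \<in> sets lebesgue \<and> T \<in> sets lebesgue \<and> S \<subseteq> unit_iv \<and> T \<subseteq> unit_iv}.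
        \<bar>LINT p:S \<times> T|lebesgue. U p\<bar>)"

definition cut_norm3 :: "(real \<times> real \<Rightarrow> real^3) \<Rightarrow> real" where
  "cut_norm3 U = (\<Sum>a\<in>UNIV. cut_norm (\<lambda>p. U p $ a))"

definition mp_bijections :: "(real \<Rightarrow> real) set" where
  "mp_bijections = {\<phi>. bij_betw \<phi> unit_iv unit_iv \<and>
     \<phi> \<in> measurable (lebesgue_on unit_iv) (lebesgue_on unit_iv) \<and>
     distr (lebesgue_on unit_iv) (lebesgue_on unit_iv) \<phi> = lebesgue_on unit_iv}"

definition relabel :: "(real \<Rightarrow> real) \<Rightarrow> (real \<times> real \<Rightarrow> real^3) \<Rightarrow> real \<times> real \<Rightarrow> real^3" where
  "relabel \<phi> W = (\<lambda>(x, y). W (\<phi> x, \<phi> y))"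

definition cut_dist3 :: "(real \<times> real \<Rightarrow> real^3) \<Rightarrow> (real \<times> real \<Rightarrow> real^3) \<Rightarrow> real" where
  "cut_dist3 U W = (INF \<phi> \<in> mp_bijections. cut_norm3 (\<lambda>p. U p - relabel \<phi> W p))"

definition graphon3_rel :: "((real \<times> real \<Rightarrow> real^3) \<times> (real \<times> real \<Rightarrow> real^3)) set" where
  "graphon3_rel = {(U, W). U \<in> graphons3 \<and> W \<in> graphons3 \<and> cut_dist3 U W = 0}"

definition graphon3_classes :: "(real \<times> real \<Rightarrow> real^3) set set" where
  "graphon3_classes = graphons3 // graphon3_rel"

definition T_functional :: "real^3 \<Rightarrow> real \<Rightarrow> (real \<times> real \<Rightarrow> real^3) \<Rightarrow> real" where
  "T_functional \<beta> \<beta>\<^sub>4 W =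
     (\<Sum>a\<in>UNIV. \<beta> $ a * (LINT p:unit_iv \<times> unit_iv|lebesgue. W p $ a)) +
     \<beta>\<^sub>4 * (LINT p:unit_iv \<times> unit_iv \<times> unit_iv|lebesgue.
             (case p of (x, y, z) \<Rightarrow> W (x, y) $ 1 * W (y, z) $ 2 * W (z, x) $ 3))"

text \<open>The convention 0 log 0 = 0 is respected because 0 * t = 0 for every real t.\<close>

definition I_functional :: "(real \<times> real \<Rightarrow> real^3) \<Rightarrow> real" where
  "I_functional W =
     (\<Sum>a\<in>UNIV. LINT p:unit_iv \<times> unit_iv|lebesgue. W p $ a * ln (W p $ a))"

text \<open>
  The value of a functional on an equivalence class. It is applied only to functionals that
  are invariant under \<^const>\<open>graphon3_rel\<close>, for which the choice of representative is immaterial.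
\<close>

definition on_class ::
    "((real \<times> real \<Rightarrow> real^3) \<Rightarrow> real) \<Rightarrow> (real \<times> real \<Rightarrow> real^3) set \<Rightarrow> real" where
  "on_class F C = F (SOME W. W \<in> C)"

definition objective :: "real^3 \<Rightarrow> real \<Rightarrow> (real \<times> real \<Rightarrow> real^3) set \<Rightarrow> real" where
  "objective \<beta> \<beta>\<^sub>4 = on_class (\<lambda>W. T_functional \<beta> \<beta>\<^sub>4 W - 1 / 2 * I_functional W)"

definition is_maximizer :: "real^3 \<Rightarrow> real \<Rightarrow> (real \<times> real \<Rightarrow> real^3) set \<Rightarrow> bool" where
  "is_maximizer \<beta> \<beta>\<^sub>4 C \<longleftrightarrow> is_arg_max (objective \<beta> \<beta>\<^sub>4) (\<lambda>D. D \<in> graphon3_classes) C"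

end

theory Submission
  imports Defs "HOL-Probability.Hoeffding"
begin

text \<open>
  Let \<open>c\<close> be a constant solution of the Euler--Lagrange equation
  \<open>ln c\<^sub>a = 2 \<beta>\<^sub>a + 2 \<beta>\<^sub>4 c\<^sub>b c\<^sub>d - L\<close>, which exists by Brouwer's theorem. For a graphon \<open>W\<close> put
  \<open>\<kappa> = 1/2 \<integral> KL(W | c)\<close>. By the Euler--Lagrange equation the objective at \<open>W\<close> equals its value at
  \<open>c\<close> minus \<open>\<kappa>\<close> plus \<open>\<beta>\<^sub>4 R\<close>, where \<open>R\<close> is the remainder of the first-order expansion of the
  triangle density at \<open>c\<close>. After symmetrizing in \<open>x, y, z\<close>, the integrand of \<open>R\<close> is a sum over pairs
  of edges of convex combinations of the mixed products of the deviations \<open>W - c\<close> on the two edges,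
  and Pinsker's inequality \<open>(W\<^sub>a - c\<^sub>a)\<^sup>2 \<le> 1/2 KL(W | c)\<close> gives \<open>\<bar>R\<bar> \<le> \<kappa>\<close>. So the objective
  falls short of its value at \<open>c\<close> by at least \<open>(1 - \<bar>\<beta>\<^sub>4\<bar>) \<kappa>\<close>, and \<open>\<kappa> = 0\<close> only if \<open>W = c\<close> almost
  everywhere. Finally, testing with preimages of rectangles shows that cut distance \<open>0\<close> from \<open>c\<close>
  means equality with \<open>c\<close> almost everywhere.
\<close>

section \<open>Pointwise inequalities on the simplex\<close>

lemma simplex3_iff:
  "\<mu> \<in> simplex3 \<longleftrightarrow> (\<forall>a. 0 \<le> \<mu> $ a) \<and> \<mu> $ 1 + \<mu> $ 2 + \<mu> $ 3 = 1"
proof -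
  have "\<mu> $ a \<le> 1" if "\<forall>a. 0 \<le> \<mu> $ a" "\<mu> $ 1 + \<mu> $ 2 + \<mu> $ 3 = 1" for a
    using that exhaust_3[of a] by (auto simp: forall_3)
  then show ?thesis by (auto simp: simplex3_def)
qed

text \<open>Hoeffding's lemma for a Bernoulli variable with parameter \<open>q\<close>. The
  auxiliary inequality it rests on covers \<open>h \<ge> 0\<close>; for negative \<open>h\<close>
  the two outcomes are exchanged, which turns \<open>h\<close> into \<open>- h\<close> and
  \<open>q\<close> into \<open>1 - q\<close>.\<close>

lemma ln_bernoulli_mgf_le:
  fixes q h :: real
  assumes "0 < q" "q < 1"
  shows "ln (1 - q + q * exp h) \<le> h * q + h\<^sup>2 / 8"
proof (cases "h \<ge> 0")
  case True
  then show ?thesis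
    using Hoeffdings_lemma_aux[of h q] assms by (simp add: algebra_simps)
next
  case False
  have "1 - q + q * exp h = exp h * (1 + (1 - q) * (exp (- h) - 1))"
    by (simp add: exp_minus field_simps)
  moreover have "0 < 1 + (1 - q) * (exp (- h) - 1)"
    using assms False by (intro add_pos_nonneg mult_nonneg_nonneg) auto
  ultimately have "ln (1 - q + q * exp h) = h + ln (1 + (1 - q) * (exp (- h) - 1))"
    by (simp add: ln_mult)
  then show ?thesis
    using Hoeffdings_lemma_aux[of "- h" "1 - q"] assms False by (simp add: algebra_simps)
qed

text \<open>This is \<open>w\<close> times the inequality ln t \<le> t - 1 at t = v / w. Summed over
  the colors of two probability vectors, it becomes Gibbs' inequality.\<close>

lemma gibbs_pointwise:
  fixes w v :: real
  assumes "0 \<le> w" "0 < v"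
  shows "w - v \<le> w * ln w - w * ln v"
proof (cases "w = 0")
  case False
  then have "ln (v / w) \<le> v / w - 1"
    using assms by (intro ln_le_minus_one) simp
  then have "w * ln (v / w) \<le> w * (v / w - 1)"
    using assms by (intro mult_left_mono)
  then show ?thesis
    using assms False by (simp add: ln_div algebra_simps)
qed (use assms in simp)

text \<open>Half the Kullback-Leibler divergence of \<open>w\<close> from \<open>c\<close>. The
  factor 1/2 matches the weight of the entropy in the objective, and keeping the logarithms apart
  covers vanishing coordinates of \<open>w\<close>.\<close>

definition half_rel_entropy :: "real^3 \<Rightarrow> real^3 \<Rightarrow> real" where
  "half_rel_entropy c w = (\<Sum>a\<in>UNIV. w $ a * ln (w $ a) - w $ a * ln (c $ a)) / 2"

lemma half_rel_entropy_self [simp]: "half_rel_entropy c c = 0"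
  by (simp add: half_rel_entropy_def)

text \<open>The idea is to test the Gibbs variational principle against the exponential tilt of \<open>c\<close> in
  the coordinate \<open>b\<close>, bounding the normalizing constant by Hoeffding's lemma.\<close>

lemma pinsker:
  assumes w: "w \<in> simplex3" and c: "c \<in> simplex3" and pos: "\<And>a. 0 < c $ a"
  shows "(w $ b - c $ b)\<^sup>2 \<le> half_rel_entropy c w"
proof -
  have csum: "(\<Sum>a\<in>UNIV. c $ a) = 1" and wsum: "(\<Sum>a\<in>UNIV. w $ a) = 1" and w0: "\<And>a. 0 \<le> w $ a"
    using c w by (auto simp: simplex3_iff sum_3)
  have b1: "c $ b < 1"
    using csum pos[of 1] pos[of 2] pos[of 3] exhaust_3[of b] by (auto simp: sum_3)
  \<comment> \<open>For every tilt parameter h the argument yields 0 \<le> 2 K - h d + h^2 / 8, with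
    d the deviation in coordinate \<open>b\<close> and K the half relative entropy. The choice h = 4
    d minimizes the right-hand side and leaves 2 K - 2 d^2.\<close>
  define h where "h = 4 * (w $ b - c $ b)"
  define e where "e a = (if a = b then h else 0)" for a
  define Z where "Z = 1 - c $ b + c $ b * exp h"
  define v where "v a = c $ a * exp (e a) / Z" for a
  have Z: "0 < Z" using b1 pos[of b] by (simp add: Z_def add_pos_pos)
  have "(\<Sum>a\<in>UNIV. c $ a * exp (e a)) = (\<Sum>a\<in>UNIV. c $ a + (if a = b then c $ b * (exp h - 1) else 0))"
    by (intro sum.cong) (auto simp: e_def algebra_simps)
  also have "\<dots> = Z"
    by (simp add: sum.distrib csum Z_def algebra_simps)
  finally have vsum: "(\<Sum>a\<in>UNIV. v a) = 1"
    using Z by (simp add: v_def flip: sum_divide_distrib)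
  have lnv: "ln (v a) = ln (c $ a) + e a - ln Z" for a
    using pos[of a] Z by (simp add: v_def ln_div ln_mult)
  have "0 = (\<Sum>a\<in>UNIV. w $ a - v a)"
    by (simp add: sum_subtractf vsum wsum)
  also have "\<dots> \<le> (\<Sum>a\<in>UNIV. w $ a * ln (w $ a) - w $ a * ln (v a))"
    using w0 pos Z by (intro sum_mono gibbs_pointwise) (auto simp: v_def)
  also have "\<dots> = (\<Sum>a\<in>UNIV. (w $ a * ln (w $ a) - w $ a * ln (c $ a)) -
      (if a = b then w $ b * h else 0) + w $ a * ln Z)"
    by (intro sum.cong) (auto simp: lnv e_def algebra_simps)
  also have "\<dots> = 2 * half_rel_entropy c w - w $ b * h + ln Z"
    by (simp add: sum.distrib sum_subtractf half_rel_entropy_def wsum flip: sum_distrib_right)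
  also have "\<dots> \<le> 2 * half_rel_entropy c w - w $ b * h + (h * c $ b + h\<^sup>2 / 8)"
    using ln_bernoulli_mgf_le[of "c $ b" h] pos[of b] b1 by (simp add: Z_def)
  also have "\<dots> = 2 * half_rel_entropy c w - 2 * (w $ b - c $ b)\<^sup>2"
    by (simp add: h_def power2_eq_square field_simps)
  finally show ?thesis by simp
qed

section \<open>The second-order remainder of the permanent\<close>

text \<open>Each of the two products is at most half the sum of the squares of its factors, hence at
  most (k + l) / 2 in absolute value.\<close>

lemma abs_cross_le:
  fixes a b a' b' :: real
  assumes "a\<^sup>2 \<le> k" "a'\<^sup>2 \<le> k" "b\<^sup>2 \<le> l" "b'\<^sup>2 \<le> l"
  shows "\<bar>a * b + a' * b'\<bar> \<le> k + l"
proof -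
  have "0 \<le> (a - b)\<^sup>2" "0 \<le> (a + b)\<^sup>2" "0 \<le> (a' - b')\<^sup>2" "0 \<le> (a' + b')\<^sup>2" by simp_all
  then show ?thesis
    using assms unfolding power2_sum power2_diff by linarith
qed

lemma convex_abs_le:
  fixes x1 x2 x3 :: real
  assumes "\<mu> \<in> simplex3" "\<bar>x1\<bar> \<le> K" "\<bar>x2\<bar> \<le> K" "\<bar>x3\<bar> \<le> K"
  shows "\<bar>\<mu> $ 1 * x1 + \<mu> $ 2 * x2 + \<mu> $ 3 * x3\<bar> \<le> K"
proof -
  have \<mu>: "\<And>a. 0 \<le> \<mu> $ a" "\<mu> $ 1 + \<mu> $ 2 + \<mu> $ 3 = 1"
    using assms by (auto simp: simplex3_iff)
  have "\<bar>\<mu> $ a * x\<bar> \<le> \<mu> $ a * K" if "\<bar>x\<bar> \<le> K" for a x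
    using \<mu>(1)[of a] that by (simp add: abs_mult mult_left_mono)
  from this[of x1 1] this[of x2 2] this[of x3 3] assms
  have "\<bar>\<mu> $ 1 * x1 + \<mu> $ 2 * x2 + \<mu> $ 3 * x3\<bar> \<le> (\<mu> $ 1 + \<mu> $ 2 + \<mu> $ 3) * K"
    unfolding distrib_right by linarith
  then show ?thesis by (simp add: \<mu>)
qed

lemma abs_add3_le:
  fixes u v w k l m :: real
  assumes "\<bar>u\<bar> \<le> k + l" "\<bar>v\<bar> \<le> k + m" "\<bar>w\<bar> \<le> l + m"
  shows "\<bar>u + v + w\<bar> \<le> 2 * (k + l + m)"
proof -
  have "u + v + w \<le> (k + l) + (k + m) + (l + m)" "- u + - v + - w \<le> (k + l) + (k + m) + (l + m)"
    using assms unfolding abs_le_iff by (intro add_mono; simp)+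
  then show ?thesis unfolding abs_le_iff by (simp add: algebra_simps)
qed

text \<open>The permanent of the 3 x 3 matrix with rows \<open>A\<close>, \<open>B\<close>,
  \<open>C\<close>: the sum over all ways to give the three edges of a triangle distinct
  colors.\<close>

definition perm3 :: "real^3 \<Rightarrow> real^3 \<Rightarrow> real^3 \<Rightarrow> real" where
  "perm3 A B C = A $ 1 * B $ 2 * C $ 3 + A $ 1 * B $ 3 * C $ 2 + A $ 2 * B $ 1 * C $ 3 +
     A $ 2 * B $ 3 * C $ 1 + A $ 3 * B $ 1 * C $ 2 + A $ 3 * B $ 2 * C $ 1"

text \<open>The gradient of the product of the three coordinates. Addition in the index type is
  modulo 3, so \<open>a + 1\<close> and \<open>a + 2\<close> are the two other colors, and arguments
  can be uniform in \<open>a\<close>.\<close>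

definition triangle_grad :: "real^3 \<Rightarrow> real^3" where
  "triangle_grad c = (\<chi> a. c $ (a + 1) * c $ (a + 2))"

lemma triangle_grad_simps [simp]:
  "triangle_grad c $ 1 = c $ 2 * c $ 3"
  "triangle_grad c $ 2 = c $ 3 * c $ 1"
  "triangle_grad c $ 3 = c $ 1 * c $ 2"
proof -
  have "(1 + 1 :: 3) = 2" "(1 + 2 :: 3) = 3" "(2 + 1 :: 3) = 3" "(2 + 2 :: 3) = 1"
    "(3 + 1 :: 3) = 1" "(3 + 2 :: 3) = 2" by simp_all
  then show "triangle_grad c $ 1 = c $ 2 * c $ 3" "triangle_grad c $ 2 = c $ 3 * c $ 1"
    "triangle_grad c $ 3 = c $ 1 * c $ 2"
    unfolding triangle_grad_def vec_lambda_beta by (simp_all only:)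
qed

lemma triangle_grad_inner: "triangle_grad c \<bullet> w = c $ 2 * c $ 3 * w $ 1 + c $ 3 * c $ 1 * w $ 2 + c $ 1 * c $ 2 * w $ 3"
  by (simp add: inner_vec_def sum_3)

lemma compact_simplex3: "compact simplex3"
proof -
  have eq: "simplex3 = cbox 0 1 \<inter> {\<mu>. \<mu> $ 1 + \<mu> $ 2 + \<mu> $ 3 = 1}"
    by (auto simp: simplex3_def mem_box_cart)
  show ?thesis
    unfolding eq by (intro compact_Int_closed compact_cbox closed_Collect_eq continuous_intros)
qed

lemma convex_simplex3: "convex simplex3"
  unfolding convex_def
proof clarsimp
  fix x y :: "real^3" and u v :: real
  assume *: "x \<in> simplex3" "y \<in> simplex3" "0 \<le> u" "0 \<le> v" "u + v = 1"
  have "u * (x $ 1 + x $ 2 + x $ 3) + v * (y $ 1 + y $ 2 + y $ 3) = 1"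
    using * by (simp add: simplex3_iff)
  then have "(u * x $ 1 + v * y $ 1) + (u * x $ 2 + v * y $ 2) + (u * x $ 3 + v * y $ 3) = 1"
    by (simp only: distrib_left add_ac)
  then show "u *\<^sub>R x + v *\<^sub>R y \<in> simplex3"
    using * by (simp add: simplex3_iff)
qed

text \<open>After subtracting its first-order expansion at \<open>(c, c, c)\<close>, the permanent is a sum over the
  three pairs of arguments of averages of the cross terms \<open>p\<^sub>b q\<^sub>d + p\<^sub>d q\<^sub>b\<close>; the cubic term is
  distributed evenly over the pairs, so the averaging weights \<open>c + s / 3\<close> lie in the simplex.\<close>

lemma permanent_expansion:
  fixes c1 c2 c3 p1 p2 p3 q1 q2 q3 s1 s2 s3 :: real
  shows "(c1 + p1) * (c2 + q2) * (c3 + s3) + (c1 + p1) * (c3 + q3) * (c2 + s2) +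
     (c2 + p2) * (c1 + q1) * (c3 + s3) + (c2 + p2) * (c3 + q3) * (c1 + s1) +
     (c3 + p3) * (c1 + q1) * (c2 + s2) + (c3 + p3) * (c2 + q2) * (c1 + s1)
     - 2 * (c2 * c3 * (c1 + p1 + (c1 + q1) + (c1 + s1)) + c3 * c1 * (c2 + p2 + (c2 + q2) + (c2 + s2)) +
        c1 * c2 * (c3 + p3 + (c3 + q3) + (c3 + s3))) + 12 * (c1 * c2 * c3) =
     ((c1 + s1 / 3) * (p2 * q3 + p3 * q2) + (c2 + s2 / 3) * (p3 * q1 + p1 * q3) +
      (c3 + s3 / 3) * (p1 * q2 + p2 * q1)) +
     ((c1 + q1 / 3) * (p2 * s3 + p3 * s2) + (c2 + q2 / 3) * (p3 * s1 + p1 * s3) +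
      (c3 + q3 / 3) * (p1 * s2 + p2 * s1)) +
     ((c1 + p1 / 3) * (q2 * s3 + q3 * s2) + (c2 + p2 / 3) * (q3 * s1 + q1 * s3) +
      (c3 + p3 / 3) * (q1 * s2 + q2 * s1))"
proof -
  \<comment> \<open>Writing every deviation as three times a new variable clears the denominators
    and leaves a polynomial identity.\<close>
  define t1 t2 t3 u1 u2 u3 v1 v2 v3
    where "t1 = s1 / 3" and "t2 = s2 / 3" and "t3 = s3 / 3"
      and "u1 = p1 / 3" and "u2 = p2 / 3" and "u3 = p3 / 3"
      and "v1 = q1 / 3" and "v2 = q2 / 3" and "v3 = q3 / 3"
  have eqs: "s1 = 3 * t1" "s2 = 3 * t2" "s3 = 3 * t3" "p1 = 3 * u1" "p2 = 3 * u2" "p3 = 3 * u3"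
    "q1 = 3 * v1" "q2 = 3 * v2" "q3 = 3 * v3"
    by (simp_all add: t1_def t2_def t3_def u1_def u2_def u3_def v1_def v2_def v3_def)
  have third: "3 * x / 3 = x" for x :: real by simp
  show ?thesis unfolding eqs third by algebra
qed

text \<open>The left-hand side is \<open>perm3\<close> minus its first-order expansion at
  \<open>(c, c, c)\<close>: the value there is 6 c1 c2 c3, the derivative in each argument is twice
  \<open>triangle_grad c\<close>, and \<open>triangle_grad c \<bullet> c\<close> is 3 c1 c2 c3, so
  the constants combine to 6 - 18 = -12. Each of the three pairs of arguments contributes at most
  the sum of its two bounds, and each argument lies in two pairs.\<close>

lemma perm3_remainder_le:
  assumes c: "c \<in> simplex3" and S: "A \<in> simplex3" "B \<in> simplex3" "C \<in> simplex3"
    and k: "\<And>a. (A $ a - c $ a)\<^sup>2 \<le> kA" "\<And>a. (B $ a - c $ a)\<^sup>2 \<le> kB" "\<And>a. (C $ a - c $ a)\<^sup>2 \<le> kC"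
  shows "\<bar>perm3 A B C - 2 * (triangle_grad c \<bullet> (A + B + C)) + 12 * (c $ 1 * c $ 2 * c $ 3)\<bar>
     \<le> 2 * (kA + kB + kC)"
    (is "\<bar>?R\<bar> \<le> _")
proof -
  define x where "x p q b d = p $ b * q $ d + p $ d * q $ b" for p q :: "real^3" and b d
  define y where "y s p q = (c $ 1 + s $ 1 / 3) * x p q 2 3 + (c $ 2 + s $ 2 / 3) * x p q 3 1 +
    (c $ 3 + s $ 3 / 3) * x p q 1 2" for s p q :: "real^3"
  have y: "\<bar>y (X - c) (P - c) (Q - c)\<bar> \<le> k + l"
    if X: "X \<in> simplex3" and k: "\<And>a. (P $ a - c $ a)\<^sup>2 \<le> k" and l: "\<And>a. (Q $ a - c $ a)\<^sup>2 \<le> l" for X P Q k l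
  proof -
    have "(2 / 3) *\<^sub>R c + (1 / 3) *\<^sub>R X \<in> simplex3"
      using X c by (intro convexD convex_simplex3) auto
    moreover have "(2 / 3) *\<^sub>R c + (1 / 3) *\<^sub>R X = c + (1 / 3) *\<^sub>R (X - c)"
      by (simp add: vec_eq_iff field_simps)
    ultimately have "c + (1 / 3) *\<^sub>R (X - c) \<in> simplex3" by simp
    moreover have "\<bar>x (P - c) (Q - c) b d\<bar> \<le> k + l" for b d
      unfolding x_def vector_minus_component by (intro abs_cross_le k l)
    ultimately show ?thesis
      using convex_abs_le[of "c + (1 / 3) *\<^sub>R (X - c)"] by (simp add: y_def)
  qed
  define p q s where "p = A - c" and "q = B - c" and "s = C - c"
  have ABC: "A = c + p" "B = c + q" "C = c + s"
    by (simp_all add: p_def q_def s_def)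
  have "?R = y s p q + y q p s + y p q s"
    unfolding ABC perm3_def triangle_grad_inner y_def x_def vector_add_component
    by (rule permanent_expansion)
  moreover have "\<bar>y s p q + y q p s + y p q s\<bar> \<le> 2 * (kA + kB + kC)"
    unfolding p_def q_def s_def by (intro abs_add3_le y S k)
  ultimately show ?thesis by (simp only:)
qed

text \<open>A solution is a fixed point of the map that sends a simplex point to its normalized
  exponential weights; Brouwer's theorem provides one, exponentials make it positive, and
  \<open>L\<close> is the logarithm of the normalizing constant at the fixed point. Its uniqueness
  is not addressed here.\<close>

lemma euler_lagrange_solution:
  fixes \<beta> :: "real^3" and \<beta>\<^sub>4 :: real
  obtains c L where "c \<in> simplex3" "\<And>a. 0 < c $ a"
    "\<And>a. ln (c $ a) = 2 * \<beta> $ a + 2 * \<beta>\<^sub>4 * triangle_grad c $ a - L"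
proof -
  define E where "E \<mu> a = exp (2 * \<beta> $ a + 2 * \<beta>\<^sub>4 * triangle_grad \<mu> $ a)" for \<mu> :: "real^3" and a
  define Z where "Z \<mu> = E \<mu> 1 + E \<mu> 2 + E \<mu> 3" for \<mu>
  define f :: "real^3 \<Rightarrow> real^3" where "f \<mu> = (\<chi> a. E \<mu> a / Z \<mu>)" for \<mu>
  have E: "0 < E \<mu> a" for \<mu> a by (simp add: E_def)
  have Z: "0 < Z \<mu>" for \<mu> by (simp add: Z_def E add_pos_pos)
  have f: "f \<mu> \<in> simplex3" for \<mu>
    using E[of \<mu>] Z[of \<mu>] by (auto simp: simplex3_iff f_def less_imp_le Z_def simp flip: add_divide_distrib)
  have "continuous_on simplex3 f"
    unfolding f_def Z_def E_def triangle_grad_def vec_lambda_beta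
    by (intro continuous_intros continuous_on_vec_lambda)
      (use Z in \<open>auto simp: Z_def E_def triangle_grad_def less_imp_neq[symmetric]\<close>)
  then obtain c where c: "c \<in> simplex3" "f c = c"
    using brouwer[OF compact_simplex3 convex_simplex3, of f] f by (metis Pi_I empty_iff)
  have ca: "c $ a = E c a / Z c" for a
    using c(2) unfolding f_def by (metis vec_lambda_beta)
  have "ln (c $ a) = 2 * \<beta> $ a + 2 * \<beta>\<^sub>4 * triangle_grad c $ a - ln (Z c)" for a
    unfolding ca using E[of c a] Z[of c] by (simp add: ln_div) (simp add: E_def)
  moreover have "0 < c $ a" for a
    unfolding ca using E Z by simp
  ultimately show thesis using that c(1) by blast
qed

section \<open>The uniform measure on the unit square and cube\<close>

text \<open>Lebesgue measure on the plane is a completion and not a product measure, so Fubini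
  arguments are run with this Borel measure instead. Using a density rather than a restriction keeps
  the whole line as the space, so Borel functions can be used directly.\<close>

definition unif :: "real measure" where
  "unif = density lborel (indicator {0..1})"

abbreviation unif2 :: "(real \<times> real) measure" where
  "unif2 \<equiv> unif \<Otimes>\<^sub>M unif"

abbreviation unif3 :: "(real \<times> real \<times> real) measure" where
  "unif3 \<equiv> unif \<Otimes>\<^sub>M unif2"

lemma sets_unif [measurable_cong, simp]: "sets unif = sets borel"
  by (simp add: unif_def)

lemma space_unif [simp]: "space unif = UNIV"
  by (simp add: unif_def)

interpretation unif: prob_space unif
  by (rule prob_spaceI) (simp add: unif_def emeasure_density)

interpretation unif2: pair_prob_space unif unif ..

interpretation unif3: pair_prob_space unif unif2 ..

lemma sets_unif2: "sets unif2 = sets (borel :: (real \<times> real) measure)"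
  by (simp add: borel_prod[symmetric] cong: sets_pair_measure_cong)

lemma sets_unif3: "sets unif3 = sets (borel :: (real \<times> real \<times> real) measure)"
  using sets_pair_measure_cong[OF sets_unif sets_unif2] by (simp only: borel_prod)

lemma space_unif2 [simp]: "space unif2 = UNIV" and space_unif3 [simp]: "space unif3 = UNIV"
  by (simp_all add: space_pair_measure)

lemma borel_measurable_unif2:
  "f \<in> borel_measurable borel \<Longrightarrow> (f :: real \<times> real \<Rightarrow> 'b::topological_space) \<in> borel_measurable unif2"
  by (simp add: measurable_cong_sets[OF sets_unif2 refl])

text \<open>With \<open>A\<close> the interval this gives the square, with \<open>A\<close> the
  square it gives the cube.\<close>

lemma unif_times_density:
  fixes A :: "'a::euclidean_space set"
  assumes "A \<in> sets borel" "emeasure lborel A < \<infinity>"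
  shows "unif \<Otimes>\<^sub>M density lborel (indicator A) = density lborel (indicator ({0..1} \<times> A))"
proof -
  have "finite_measure (density lborel (indicator A :: 'a \<Rightarrow> ennreal))"
    using assms by (intro finite_measureI) (simp add: emeasure_density)
  then have "unif \<Otimes>\<^sub>M density lborel (indicator A) =
      density (lborel \<Otimes>\<^sub>M lborel) (\<lambda>(x, y). indicator {0..1} x * indicator A y)"
    unfolding unif_def using assms
    by (intro pair_measure_density) (auto simp: sigma_finite_lborel finite_measure.axioms)
  then show ?thesis
    by (simp add: lborel_prod indicator_times[abs_def] case_prod_unfold)
qed

lemma unif2_eq_density: "unif2 = density lborel (indicator (unit_iv \<times> unit_iv))"
  using unif_times_density[of "{0..1::real}"] by (simp flip: unif_def)

lemma unif3_eq_density: "unif3 = density lborel (indicator (unit_iv \<times> unit_iv \<times> unit_iv))"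
proof -
  have "emeasure lborel (unit_iv \<times> unit_iv) < \<infinity>"
    using emeasure_bounded_finite[of "unit_iv \<times> unit_iv"] by (simp add: bounded_Times)
  moreover have "unit_iv \<times> unit_iv \<in> sets borel"
    by (simp add: borel_closed closed_Times)
  ultimately show ?thesis
    by (simp add: unif2_eq_density unif_times_density)
qed

section \<open>Passing from Lebesgue to Borel integrands\<close>

text \<open>Preimages under \<open>f\<close> and \<open>f'\<close> differ by null sets, and a
  complete measure measures every set that agrees almost everywhere with a measurable one.\<close>

lemma borel_measurable_completion_AE_eq:
  assumes "f' \<in> M \<rightarrow>\<^sub>M N" "AE x in M. f x = f' x" "\<And>x. f x \<in> space N"
  shows "f \<in> completion M \<rightarrow>\<^sub>M N"
proof (rule measurableI)
  fix A assume A: "A \<in> sets N"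
  have "AE x in completion M. x \<in> f' -` A \<inter> space M \<longleftrightarrow> x \<in> f -` A \<inter> space M"
    using AE_completion[OF assms(2)] by eventually_elim simp
  then show "f -` A \<inter> space (completion M) \<in> sets (completion M)"
    using completion.in_sets_AE[where M=M, of "f' -` A \<inter> space M" "f -` A \<inter> space M"] measurable_sets[OF assms(1) A]
    by simp
qed (use assms in auto)

lemma AE_lebesgue_on_iff:
  fixes S :: "'a::euclidean_space set"
  assumes "S \<in> sets borel"
  shows "(AE p in lebesgue_on S. P p) \<longleftrightarrow> (AE p in density lborel (indicator S). P p)"
  using assms
  by (simp add: AE_restrict_space_iff AE_completion_iff AE_density indicator_def cong: if_cong)

text \<open>The bridge from the integrals in the definitions to the product measures: replace the
  integrand by a Borel version, drop the completion, and absorb the indicator into the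
  density.\<close>

lemma set_integral_lebesgue_eq:
  fixes f f' :: "'a::euclidean_space \<Rightarrow> real"
  assumes S: "S \<in> sets borel" and f': "f' \<in> borel_measurable borel"
    and eq: "AE p in density lborel (indicator S). f p = f' p"
  shows "(LINT p:S|lebesgue. f p) = (\<integral>p. f' p \<partial>density lborel (indicator S))"
proof -
  have [measurable]: "f' \<in> borel_measurable lborel" "(indicator S :: 'a \<Rightarrow> real) \<in> borel_measurable lborel"
    using S f' by auto
  have eq': "AE p in lborel. indicator S p *\<^sub>R f p = indicator S p *\<^sub>R f' p"
    using eq S by (auto simp: AE_density indicator_def elim!: eventually_mono)
  have "(LINT p:S|lebesgue. f p) = (\<integral>p. indicator S p *\<^sub>R f' p \<partial>lebesgue)"
    unfolding set_lebesgue_integral_def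
    by (intro integral_cong_AE borel_measurable_completion_AE_eq[OF _ eq'] AE_completion eq'
        measurable_completion) auto
  also have "\<dots> = (\<integral>p. indicator S p *\<^sub>R f' p \<partial>lborel)"
    by (intro integral_completion) auto
  also have "\<dots> = (\<integral>p. f' p \<partial>density lborel (\<lambda>p. ennreal (indicator S p)))"
    by (intro integral_density[symmetric]) auto
  finally show ?thesis by (simp add: ennreal_indicator)
qed

lemmas set_integral_square = set_integral_lebesgue_eq[of "unit_iv \<times> unit_iv", folded unif2_eq_density]
lemmas set_integral_cube = set_integral_lebesgue_eq[of "unit_iv \<times> unit_iv \<times> unit_iv", folded unif3_eq_density]

lemma sets_square: "unit_iv \<times> unit_iv \<in> sets borel" 
  and sets_cube: "unit_iv \<times> unit_iv \<times> unit_iv \<in> sets borel"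
  by (simp_all add: borel_closed closed_Times)

lemma AE_square_iff: "(AE p in lebesgue_on (unit_iv \<times> unit_iv). P p) \<longleftrightarrow> (AE p in unif2. P p)"
  by (simp only: unif2_eq_density AE_lebesgue_on_iff sets_square)

section \<open>Invariance of the uniform measures under permuting coordinates\<close>

lemma distr_unif2_swap: "distr unif2 unif2 (\<lambda>(x, y). (y, x)) = unif2"
  by (rule unif2.distr_pair_swap[symmetric])

lemma distr_unif3_snd: "distr unif3 unif2 snd = unif2"
proof (rule measure_eqI)
  fix A assume "A \<in> sets (distr unif3 unif2 snd)"
  then have A: "A \<in> sets unif2" by simp
  have "snd -` A \<inter> space unif3 = UNIV \<times> A" by auto
  then show "emeasure (distr unif3 unif2 snd) A = emeasure unif2 A"
    using A unif.emeasure_space_1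
    by (simp add: emeasure_distr unif2.emeasure_pair_measure_Times)
qed simp

lemma distr_unif3_swap_yz: "distr unif3 unif3 (\<lambda>(x, y, z). (x, z, y)) = unif3"
proof -
  have "distr unif unif (\<lambda>x. x) \<Otimes>\<^sub>M distr unif2 unif2 (\<lambda>(x, y). (y, x)) =
      distr unif3 unif3 (\<lambda>(x, p). (x, (\<lambda>(x, y). (y, x)) p))"
    by (intro pair_measure_distr) (auto simp: distr_unif2_swap intro: unif2.sigma_finite_measure_axioms)
  moreover have "distr unif unif (\<lambda>x. x) = unif"
    by (rule distr_id2) simp
  moreover have "(\<lambda>(x, p). (x, (\<lambda>(x, y). (y, x)) p)) = (\<lambda>(x, y, z). (x, z, y))"
    by auto
  ultimately show ?thesis
    by (metis distr_unif2_swap)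
qed

lemma emeasure_unif3:
  assumes "A \<in> sets unif3"
  shows "emeasure unif3 A = (\<integral>\<^sup>+x. \<integral>\<^sup>+y. \<integral>\<^sup>+z. indicator A (x, y, z) \<partial>unif \<partial>unif \<partial>unif)"
proof -
  have [measurable]: "A \<in> sets unif3" by fact
  have "emeasure unif3 A = (\<integral>\<^sup>+x. \<integral>\<^sup>+p. indicator A (x, p) \<partial>unif2 \<partial>unif)"
    using assms by (simp add: unif2.nn_integral_fst)
  also have "\<dots> = (\<integral>\<^sup>+x. \<integral>\<^sup>+y. \<integral>\<^sup>+z. indicator A (x, y, z) \<partial>unif \<partial>unif \<partial>unif)"
    by (subst unif.nn_integral_fst[symmetric]) simp_all
  finally show ?thesis .
qed

text \<open>Triples are nested to the right, so this exchange is not a product of maps on the two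
  factors. The measure is therefore written as an iterated integral, and Fubini's theorem exchanges
  the two outer integrations.\<close>

lemma distr_unif3_swap_xy: "distr unif3 unif3 (\<lambda>(x, y, z). (y, x, z)) = unif3"
proof (rule measure_eqI)
  fix A assume "A \<in> sets (distr unif3 unif3 (\<lambda>(x, y, z). (y, x, z)))"
  then have [measurable]: "A \<in> sets unif3" by simp
  let ?B = "(\<lambda>(x, y, z). (y, x, z)) -` A \<inter> space unif3"
  have "emeasure (distr unif3 unif3 (\<lambda>(x, y, z). (y, x, z))) A = emeasure unif3 ?B"
    by (rule emeasure_distr) measurable
  also have "\<dots> = (\<integral>\<^sup>+x. \<integral>\<^sup>+y. \<integral>\<^sup>+z. indicator ?B (x, y, z) \<partial>unif \<partial>unif \<partial>unif)"
    by (rule emeasure_unif3) measurable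
  also have "\<dots> = (\<integral>\<^sup>+x. \<integral>\<^sup>+y. (\<integral>\<^sup>+z. indicator A (y, x, z) \<partial>unif) \<partial>unif \<partial>unif)"
    by (intro nn_integral_cong) (auto simp: indicator_def)
  also have "\<dots> = (\<integral>\<^sup>+y. \<integral>\<^sup>+x. (\<integral>\<^sup>+z. indicator A (y, x, z) \<partial>unif) \<partial>unif \<partial>unif)"
    by (rule unif2.Fubini'[symmetric]) measurable
  also have "\<dots> = emeasure unif3 A"
    by (rule emeasure_unif3[symmetric]) measurable
  finally show "emeasure (distr unif3 unif3 (\<lambda>(x, y, z). (y, x, z))) A = emeasure unif3 A" .
qed simp

definition "unif3_invariant \<sigma> \<longleftrightarrow> \<sigma> \<in> unif3 \<rightarrow>\<^sub>M unif3 \<and> distr unif3 unif3 \<sigma> = unif3"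

lemma unif3_invariant_comp:
  "unif3_invariant \<sigma> \<Longrightarrow> unif3_invariant \<tau> \<Longrightarrow> unif3_invariant (\<sigma> \<circ> \<tau>)"
  unfolding unif3_invariant_def by (auto simp: distr_distr[symmetric] intro: measurable_comp)

text \<open>The two adjacent transpositions generate all permutations; the other three are
  compositions of them.\<close>

lemma unif3_invariant_perms:
  "unif3_invariant (\<lambda>(x, y, z). (x, z, y))" (is ?yz)
  "unif3_invariant (\<lambda>(x, y, z). (y, x, z))" (is ?xy)
  "unif3_invariant (\<lambda>(x, y, z). (y, z, x))" (is ?c)
  "unif3_invariant (\<lambda>(x, y, z). (z, x, y))" (is ?d)
  "unif3_invariant (\<lambda>(x, y, z). (z, y, x))" (is ?xz)
proof -
  show yz: ?yz and xy: ?xy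
    by (simp_all add: unif3_invariant_def distr_unif3_swap_yz distr_unif3_swap_xy)
  show c: ?c
    using unif3_invariant_comp[OF yz xy] by (simp add: comp_def case_prod_unfold)
  show ?d
    using unif3_invariant_comp[OF xy yz] by (simp add: comp_def case_prod_unfold)
  show ?xz
    using unif3_invariant_comp[OF xy c] by (simp add: comp_def case_prod_unfold)
qed

lemma integral_unif3_invariant:
  fixes h :: "real \<times> real \<times> real \<Rightarrow> real"
  assumes "unif3_invariant \<sigma>" "h \<in> borel_measurable unif3"
  shows "(\<integral>p. h (\<sigma> p) \<partial>unif3) = (\<integral>p. h p \<partial>unif3)"
  using assms integral_distr[of \<sigma> unif3 unif3 h] by (simp add: unif3_invariant_def)

text \<open>Every edge of the triangle is a permutation of the coordinates followed by the
  projection to the last two.\<close>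

lemma distr_unif3_edge:
  "distr unif3 unif2 (\<lambda>(x, y, z). (y, z)) = unif2"
  "distr unif3 unif2 (\<lambda>(x, y, z). (x, y)) = unif2"
  "distr unif3 unif2 (\<lambda>(x, y, z). (z, x)) = unif2"
proof -
  have *: "distr unif3 unif2 (\<lambda>p. snd (\<sigma> p)) = unif2" if "unif3_invariant \<sigma>" for \<sigma>
  proof -
    have "distr unif3 unif2 (\<lambda>p. snd (\<sigma> p)) = distr (distr unif3 unif3 \<sigma>) unif2 snd"
      using that distr_distr[of snd unif3 unif2 \<sigma> unif3] by (simp add: unif3_invariant_def comp_def del: distr_distr)
    then show ?thesis
      using that by (simp add: unif3_invariant_def distr_unif3_snd)
  qed
  show "distr unif3 unif2 (\<lambda>(x, y, z). (y, z)) = unif2"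
    using distr_unif3_snd by (simp add: case_prod_unfold)
  show "distr unif3 unif2 (\<lambda>(x, y, z). (x, y)) = unif2"
    using *[OF unif3_invariant_perms(4)] by (simp add: case_prod_unfold)
  show "distr unif3 unif2 (\<lambda>(x, y, z). (z, x)) = unif2"
    using *[OF unif3_invariant_perms(2)] *[OF unif3_invariant_comp[OF unif3_invariant_perms(2) unif3_invariant_perms(5)]]
      *[OF unif3_invariant_perms(3)]
    by (simp add: case_prod_unfold)
qed

section \<open>Borel versions of graphons\<close>

lemma AE_unif2_square: "AE p in unif2. p \<in> unit_iv \<times> unit_iv"
  unfolding unif2_eq_density using sets_square by (subst AE_density) (auto simp: indicator_def)

lemma AE_unif2_swap:
  assumes "AE p in unif2. P p"
  shows "AE p in unif2. P (prod.swap p)"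
proof -
  have "AE p in unif2. P ((\<lambda>(x, y). (y, x)) p)"
    by (rule AE_distrD[where M' = unif2], measurable, simp only: distr_unif2_swap assms)
  then show ?thesis
    by (simp add: prod.swap_def case_prod_unfold)
qed

lemma AE_unif3_edge:
  assumes "AE p in unif2. P p"
  shows "AE p in unif3. P (case p of (x, y, z) \<Rightarrow> (y, z))"
    and "AE p in unif3. P (case p of (x, y, z) \<Rightarrow> (x, y))"
    and "AE p in unif3. P (case p of (x, y, z) \<Rightarrow> (z, x))"
  by (rule AE_distrD[where M' = unif2], measurable, simp only: distr_unif3_edge assms)+

lemma borel_measurable_vector3:
  assumes "\<And>a. f a \<in> borel_measurable M"
  shows "(\<lambda>p. \<chi> a. f a p :: real^3) \<in> borel_measurable M"
proof -
  have "(\<chi> a. f a p) = (\<Sum>a\<in>UNIV. f a p *\<^sub>R axis a 1)" for p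
    using basis_expansion[of "\<chi> a. f a p"] by (simp add: scalar_mult_eq_scaleR)
  then show ?thesis using assms by simp
qed

text \<open>Borel versions of the components agree with \<open>W\<close> only almost everywhere, so
  symmetry and simplex values may fail on a null set. That set is enlarged to a swap-invariant Borel
  null set and the function is redefined there by a constant, so both properties hold at every
  point.\<close>

lemma graphon3_borel_version:
  assumes W: "W \<in> graphons3"
  obtains V where "V \<in> borel_measurable borel" "\<And>p. V p \<in> simplex3"
    "\<And>x y. V (x, y) = V (y, x)" "AE p in unif2. W p = V p"
proof -
  let ?Q = "unit_iv \<times> unit_iv"
  have "(\<lambda>p. if p \<in> ?Q then W p else 0) \<in> borel_measurable lebesgue"
    using W sets_square by (intro borel_measurable_if_I) (auto simp: graphons3_def)
  then have "(\<lambda>p. (if p \<in> ?Q then W p else 0) $ a) \<in> borel_measurable lebesgue" for a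
    by (rule measurable_compose) measurable
  then have "\<exists>g\<in>borel_measurable lborel. AE p in lborel. (if p \<in> ?Q then W p else 0) $ a = g p" for a
    by (rule completion_ex_borel_measurable_real)
  then have "\<forall>a. \<exists>g. g \<in> borel_measurable lborel \<and> (AE p in lborel. (if p \<in> ?Q then W p else 0) $ a = g p)"
    by blast
  from choice[OF this] obtain g where g: "\<And>a. g a \<in> borel_measurable lborel"
    "\<And>a. AE p in lborel. (if p \<in> ?Q then W p else 0) $ a = g a p"
    by blast
  define V0 where "V0 p = (\<chi> a. g a p)" for p
  have V0 [measurable]: "V0 \<in> borel_measurable borel"
    unfolding V0_def using g(1) by (intro borel_measurable_vector3) simp
  have "AE p in lborel. (if p \<in> ?Q then W p else 0) = V0 p"
    using AE_finite_allI[OF finite_class.finite_UNIV, of "\<lambda>a p. (if p \<in> ?Q then W p else 0) $ a = g a p" lborel] g(2)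
    by (simp add: V0_def vec_eq_iff)
  then have "AE p in unif2. (if p \<in> ?Q then W p else 0) = V0 p"
    unfolding unif2_eq_density using sets_square by (subst AE_density) auto
  with AE_unif2_square have "AE p in unif2. p \<in> ?Q \<and> W p = V0 p"
    by eventually_elim (auto split: if_splits)
  \<comment> \<open>\<open>N\<close> also covers everything outside the unit square, so off
    \<open>N\<close> the simplex and symmetry properties of \<open>W\<close> are available.\<close>
  then obtain N where N: "{p. \<not> (p \<in> ?Q \<and> W p = V0 p)} \<subseteq> N" "N \<in> sets unif2" "AE p in unif2. p \<notin> N"
    by (elim AE_E) (simp add: AE_not_in null_setsI)
  define G where "G = - N \<inter> prod.swap -` (- N)"
  \<comment> \<open>The barycenter serves as a default value; any point of the simplex would
    do.\<close>
  define c :: "real^3" where "c = (\<chi> a. 1 / 3)"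
  define V where "V p = (if p \<in> G then V0 p else c)" for p
  have sym: "prod.swap p \<in> G \<longleftrightarrow> p \<in> G" for p
    by (auto simp: G_def)
  have G: "p \<in> ?Q \<and> W p = V0 p" if "p \<in> G" for p
    using that N(1) by (auto simp: G_def)
  have swap: "prod.swap \<in> borel_measurable (borel :: (real \<times> real) measure)"
    by (intro borel_measurable_continuous_onI continuous_on_swap)
  have "N \<in> sets borel"
    using N(2) by (simp only: sets_unif2)
  then have "G \<in> sets borel"
    unfolding G_def using measurable_sets[OF swap, of "- N"] by auto
  then have "V \<in> borel_measurable borel"
    unfolding V_def by measurable
  moreover have "V p \<in> simplex3" for p
  proof (cases "p \<in> G")
    case True
    have "W p \<in> simplex3"
      using G[OF True] W unfolding graphons3_def by blast
    with G[OF True] True show ?thesis by (simp add: V_def)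
  qed (simp add: V_def c_def simplex3_iff)
  moreover have "V (x, y) = V (y, x)" for x y
  proof (cases "(x, y) \<in> G")
    case True
    with sym[of "(x, y)"] G[of "(x, y)"] G[of "(y, x)"] W show ?thesis
      by (auto simp: V_def graphons3_def)
  next
    case False
    with sym[of "(x, y)"] show ?thesis by (simp add: V_def)
  qed
  moreover have "AE p in unif2. W p = V p"
    using N(3) AE_unif2_swap[OF N(3)] by eventually_elim (use G in \<open>auto simp: V_def G_def\<close>)
  ultimately show thesis by (rule that)
qed

lemma borel_measurable_component [measurable (raw)]:
  fixes f :: "'a \<Rightarrow> real^'n"
  shows "f \<in> borel_measurable M \<Longrightarrow> (\<lambda>p. f p $ a) \<in> borel_measurable M"
  by (rule measurable_compose[OF _ borel_measurable_nth])

text \<open>The lower bound is Gibbs' inequality against 1. Boundedness makes the entropy integrands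
  integrable.\<close>

lemma mult_ln_bounds:
  fixes t :: real
  assumes "0 \<le> t" "t \<le> 1"
  shows "\<bar>t * ln t\<bar> \<le> 1"
proof (cases "t = 0")
  case False
  then have "t * ln t \<le> 0"
    using assms by (simp add: mult_nonneg_nonpos)
  moreover have "t - 1 \<le> t * ln t"
    using gibbs_pointwise[of t 1] assms by simp
  ultimately show ?thesis using assms by linarith
qed simp

lemma simplex3_bounds:
  assumes "\<mu> \<in> simplex3"
  shows "0 \<le> \<mu> $ a" "\<mu> $ a \<le> 1" "\<bar>\<mu> $ a\<bar> \<le> 1"
  using assms by (simp_all add: simplex3_def)

lemma integrable_unif2:
  fixes f :: "real \<times> real \<Rightarrow> real"
  assumes "f \<in> borel_measurable borel" "\<And>p. \<bar>f p\<bar> \<le> B"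
  shows "integrable unif2 f"
  using assms by (intro unif2.integrable_const_bound[of _ B] borel_measurable_unif2) auto

lemma integral_unif3_edge:
  fixes f :: "real \<times> real \<Rightarrow> real"
  assumes "f \<in> borel_measurable borel"
  shows "(\<integral>p. f (case p of (x, y, z) \<Rightarrow> (y, z)) \<partial>unif3) = (\<integral>p. f p \<partial>unif2)"
    and "(\<integral>p. f (case p of (x, y, z) \<Rightarrow> (x, y)) \<partial>unif3) = (\<integral>p. f p \<partial>unif2)"
    and "(\<integral>p. f (case p of (x, y, z) \<Rightarrow> (z, x)) \<partial>unif3) = (\<integral>p. f p \<partial>unif2)"
proof -
  have *: "(\<integral>p. f (e p) \<partial>unif3) = (\<integral>p. f p \<partial>unif2)"
    if "distr unif3 unif2 e = unif2" "e \<in> unif3 \<rightarrow>\<^sub>M unif2" for e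
    using integral_distr[OF that(2) borel_measurable_unif2[OF assms]] by (simp only: that)
  show "(\<integral>p. f (case p of (x, y, z) \<Rightarrow> (y, z)) \<partial>unif3) = (\<integral>p. f p \<partial>unif2)"
    "(\<integral>p. f (case p of (x, y, z) \<Rightarrow> (x, y)) \<partial>unif3) = (\<integral>p. f p \<partial>unif2)"
    "(\<integral>p. f (case p of (x, y, z) \<Rightarrow> (z, x)) \<partial>unif3) = (\<integral>p. f p \<partial>unif2)"
    by (rule *, rule distr_unif3_edge, measurable)+
qed

lemma borel_measurable_edge:
  fixes V :: "real \<times> real \<Rightarrow> 'b::topological_space"
  assumes "V \<in> borel_measurable borel"
  shows "(\<lambda>p. V (case p of (x, y, z) \<Rightarrow> (y, z))) \<in> borel_measurable (borel :: (real \<times> real \<times> real) measure)"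
    "(\<lambda>p. V (case p of (x, y, z) \<Rightarrow> (x, y))) \<in> borel_measurable (borel :: (real \<times> real \<times> real) measure)"
    "(\<lambda>p. V (case p of (x, y, z) \<Rightarrow> (z, x))) \<in> borel_measurable (borel :: (real \<times> real \<times> real) measure)"
  unfolding case_prod_unfold
  by (intro measurable_compose[OF _ assms] borel_measurable_continuous_onI continuous_intros)+

section \<open>The functionals in terms of Borel versions\<close>

lemma T_functional_eq:
  assumes V: "V \<in> borel_measurable borel" and WV: "AE p in unif2. W p = V p"
  shows "T_functional \<beta> \<beta>\<^sub>4 W = (\<Sum>a\<in>UNIV. \<beta> $ a * (\<integral>p. V p $ a \<partial>unif2)) +
    \<beta>\<^sub>4 * (\<integral>(x, y, z). V (x, y) $ 1 * V (y, z) $ 2 * V (z, x) $ 3 \<partial>unif3)"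
proof -
  note [measurable] = V
  have "(LINT p:unit_iv \<times> unit_iv|lebesgue. W p $ a) = (\<integral>p. V p $ a \<partial>unif2)" for a
    by (intro set_integral_square sets_square) (measurable, use WV in \<open>auto elim!: eventually_mono\<close>)
  moreover have "(LINT p:unit_iv \<times> unit_iv \<times> unit_iv|lebesgue.
             (case p of (x, y, z) \<Rightarrow> W (x, y) $ 1 * W (y, z) $ 2 * W (z, x) $ 3)) =
     (\<integral>(x, y, z). V (x, y) $ 1 * V (y, z) $ 2 * V (z, x) $ 3 \<partial>unif3)"
  proof (intro set_integral_cube sets_cube)
    note [measurable] = borel_measurable_edge[OF V, unfolded case_prod_unfold]
    show "(\<lambda>(x, y, z). V (x, y) $ 1 * V (y, z) $ 2 * V (z, x) $ 3) \<in> borel_measurable borel"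
      unfolding case_prod_unfold by measurable
    show "AE p in unif3. (case p of (x, y, z) \<Rightarrow> W (x, y) $ 1 * W (y, z) $ 2 * W (z, x) $ 3) =
        (case p of (x, y, z) \<Rightarrow> V (x, y) $ 1 * V (y, z) $ 2 * V (z, x) $ 3)"
      using AE_unif3_edge[OF WV] by eventually_elim (simp add: case_prod_unfold)
  qed
  ultimately show ?thesis
    unfolding T_functional_def by simp
qed

lemma I_functional_eq:
  assumes V: "V \<in> borel_measurable borel" and WV: "AE p in unif2. W p = V p"
  shows "I_functional W = (\<Sum>a\<in>UNIV. \<integral>p. V p $ a * ln (V p $ a) \<partial>unif2)"
proof -
  note [measurable] = V
  have "(LINT p:unit_iv \<times> unit_iv|lebesgue. W p $ a * ln (W p $ a)) =
      (\<integral>p. V p $ a * ln (V p $ a) \<partial>unif2)" for a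
    by (intro set_integral_square sets_square) (measurable, use WV in \<open>auto elim!: eventually_mono\<close>)
  then show ?thesis
    unfolding I_functional_def by simp
qed

text \<open>The symmetrization is essential: the remainder bound holds for the permanent, but fails for the
  unsymmetrized integrand, whose weights on the mixed products need not sum to \<open>1\<close>.\<close>

lemma triangle_integral_eq_perm3:
  assumes V: "V \<in> borel_measurable borel" and simplex: "\<And>p. V p \<in> simplex3"
    and sym: "\<And>x y. V (x, y) = V (y, x)"
  shows "6 * (\<integral>(x, y, z). V (x, y) $ 1 * V (y, z) $ 2 * V (z, x) $ 3 \<partial>unif3) =
    (\<integral>(x, y, z). perm3 (V (x, y)) (V (y, z)) (V (z, x)) \<partial>unif3)"
proof -
  define h where "h = (\<lambda>(x, y, z). V (x, y) $ 1 * V (y, z) $ 2 * V (z, x) $ 3)"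
  note [measurable] = borel_measurable_edge[OF V, unfolded case_prod_unfold]
  have h [measurable]: "h \<in> borel_measurable unif3"
    unfolding h_def case_prod_unfold by (subst measurable_cong_sets[OF sets_unif3 refl]) measurable
  have hb: "\<bar>h p\<bar> \<le> 1" for p
    unfolding h_def case_prod_unfold abs_mult using simplex3_bounds(3)[OF simplex]
    by (intro mult_le_one) (auto intro: mult_nonneg_nonneg)
  have int: "integrable unif3 (\<lambda>p. h (\<sigma> p))" "(\<integral>p. h (\<sigma> p) \<partial>unif3) = (\<integral>p. h p \<partial>unif3)"
    if "unif3_invariant \<sigma>" for \<sigma>
  proof -
    have [measurable]: "\<sigma> \<in> unif3 \<rightarrow>\<^sub>M unif3"
      using that by (simp add: unif3_invariant_def)
    show "integrable unif3 (\<lambda>p. h (\<sigma> p))"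
      using hb by (intro unif3.integrable_const_bound[of _ 1]) auto
  qed (rule integral_unif3_invariant[OF that h])
  have int0: "integrable unif3 h"
    using hb by (intro unif3.integrable_const_bound[of _ 1]) auto
  note perms = unif3_invariant_perms
  \<comment> \<open>By symmetry of \<open>V\<close>, permuting the vertices only permutes the three
    edge values, so the six permuted integrands are the six colorings in the permanent.\<close>
  have "perm3 (V (x, y)) (V (y, z)) (V (z, x)) =
      h (x, y, z) + h (x, z, y) + h (y, x, z) + h (y, z, x) + h (z, x, y) + h (z, y, x)" for x y z
    by (simp add: h_def perm3_def sym[of y x] sym[of z y] sym[of x z])
  then have "(\<integral>(x, y, z). perm3 (V (x, y)) (V (y, z)) (V (z, x)) \<partial>unif3) =
     (\<integral>p. h p + h ((\<lambda>(x, y, z). (x, z, y)) p) + h ((\<lambda>(x, y, z). (y, x, z)) p) +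
       h ((\<lambda>(x, y, z). (y, z, x)) p) + h ((\<lambda>(x, y, z). (z, x, y)) p) + h ((\<lambda>(x, y, z). (z, y, x)) p) \<partial>unif3)"
    by (intro Bochner_Integration.integral_cong refl) auto
  also have "\<dots> = 6 * (\<integral>p. h p \<partial>unif3)"
    using int[OF perms(1)] int[OF perms(2)] int[OF perms(3)] int[OF perms(4)] int[OF perms(5)] int0
    by (simp only: Bochner_Integration.integral_add Bochner_Integration.integrable_add)
  finally show ?thesis by (simp add: h_def)
qed

section \<open>Expansion of the objective\<close>

lemma integrable_unif3_edge:
  fixes f :: "real \<times> real \<Rightarrow> real"
  assumes "integrable unif2 f"
  shows "integrable unif3 (\<lambda>p. f (case p of (x, y, z) \<Rightarrow> (y, z)))"
    and "integrable unif3 (\<lambda>p. f (case p of (x, y, z) \<Rightarrow> (x, y)))"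
    and "integrable unif3 (\<lambda>p. f (case p of (x, y, z) \<Rightarrow> (z, x)))"
  by (rule integrable_distr[where M' = unif2], measurable, simp only: distr_unif3_edge assms)+

lemma borel_measurable_perm3:
  assumes [measurable]: "A \<in> borel_measurable M" "B \<in> borel_measurable M" "C \<in> borel_measurable M"
  shows "(\<lambda>p. perm3 (A p) (B p) (C p)) \<in> borel_measurable M"
  unfolding perm3_def
  by (intro borel_measurable_add borel_measurable_times borel_measurable_component assms)

text \<open>The constant \<open>L / 2 - 2 * \<beta>\<^sub>4 * (c $ 1 * c $ 2 * c $ 3)\<close> is the
  objective at the constant graphon \<open>c\<close>. The exact error is
  \<open>\<beta>\<^sub>4\<close> times the triangle remainder \<open>R\<close>, which Pinsker's
  inequality controls by the integrated half relative entropy.\<close>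

lemma objective_expansion:
  fixes \<beta> c :: "real^3" and V W :: "real \<times> real \<Rightarrow> real^3"
  assumes V: "V \<in> borel_measurable borel" and simplex: "\<And>p. V p \<in> simplex3"
    and sym: "\<And>x y. V (x, y) = V (y, x)" and WV: "AE p in unif2. W p = V p"
    and c: "c \<in> simplex3" "\<And>a. 0 < c $ a"
    and EL: "\<And>a. ln (c $ a) = 2 * \<beta> $ a + 2 * \<beta>\<^sub>4 * triangle_grad c $ a - L"
  shows "integrable unif2 (\<lambda>p. half_rel_entropy c (V p))" (is ?int)
    and "\<bar>T_functional \<beta> \<beta>\<^sub>4 W - 1 / 2 * I_functional W - (L / 2 - 2 * \<beta>\<^sub>4 * (c $ 1 * c $ 2 * c $ 3)) +
        (\<integral>p. half_rel_entropy c (V p) \<partial>unif2)\<bar> \<le> \<bar>\<beta>\<^sub>4\<bar> * (\<integral>p. half_rel_entropy c (V p) \<partial>unif2)"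
      (is ?bound)
proof -
  define m where "m = (\<chi> a. \<integral>p. V p $ a \<partial>unif2)"
  define e where "e a = (\<integral>p. V p $ a * ln (V p $ a) \<partial>unif2)" for a
  define t where "t = (\<integral>(x, y, z). V (x, y) $ 1 * V (y, z) $ 2 * V (z, x) $ 3 \<partial>unif3)"
  define \<kappa> where "\<kappa> = (\<integral>p. half_rel_entropy c (V p) \<partial>unif2)"
  define ccc where "ccc = c $ 1 * c $ 2 * c $ 3"
  note [measurable] = V borel_measurable_unif2[OF V]
  have intV: "integrable unif2 (\<lambda>p. V p $ a)" for a
    using simplex3_bounds(3)[OF simplex] by (intro integrable_unif2) auto
  have intE: "integrable unif2 (\<lambda>p. V p $ a * ln (V p $ a))" for a
    using simplex3_bounds[OF simplex] by (intro integrable_unif2[where B = 1] mult_ln_bounds) auto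
  show int: ?int
    unfolding half_rel_entropy_def by (intro integrable_divide Bochner_Integration.integrable_sum Bochner_Integration.integrable_diff integrable_mult_left intV intE)
  have \<kappa>: "\<kappa> = (\<Sum>a\<in>UNIV. e a - m $ a * ln (c $ a)) / 2"
    unfolding \<kappa>_def half_rel_entropy_def using intV intE
    by (simp add: m_def e_def Bochner_Integration.integral_sum Bochner_Integration.integral_diff)
  have m: "m $ 1 + m $ 2 + m $ 3 = 1"
  proof -
    have "m $ 1 + m $ 2 + m $ 3 = (\<integral>p. V p $ 1 + V p $ 2 + V p $ 3 \<partial>unif2)"
      using intV by (simp add: m_def)
    also have "\<dots> = (\<integral>p. 1 \<partial>unif2)"
      using simplex by (intro Bochner_Integration.integral_cong refl) (simp add: simplex3_iff)
    finally show ?thesis using unif2.prob_space by simp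
  qed
  \<comment> \<open>The first-order expansion of the triangle density is \<open>ccc\<close> plus
    \<open>triangle_grad c \<bullet> (m - c)\<close>, and \<open>triangle_grad c \<bullet> c\<close>
    equals \<open>3 * ccc\<close>.\<close>
  define R where "R = t - triangle_grad c \<bullet> m + 2 * ccc"
  \<comment> \<open>The factor 6 comes from symmetrization: \<open>6 * R\<close> is the integral of
    the remainder of the permanent.\<close>
  have "\<bar>6 * R\<bar> \<le> 6 * \<kappa>"
  proof -
    define A B C :: "real \<times> real \<times> real \<Rightarrow> real^3"
      where "A p = V (case p of (x, y, z) \<Rightarrow> (x, y))" and "B p = V (case p of (x, y, z) \<Rightarrow> (y, z))"
        and "C p = V (case p of (x, y, z) \<Rightarrow> (z, x))" for p
    note edge = borel_measurable_edge[OF V, folded A_def B_def C_def]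
    have meas [measurable]: "A \<in> borel_measurable unif3" "B \<in> borel_measurable unif3" "C \<in> borel_measurable unif3"
      using edge by (simp_all only: measurable_cong_sets[OF sets_unif3 refl])
    have simp3: "A p \<in> simplex3" "B p \<in> simplex3" "C p \<in> simplex3" for p
      by (simp_all add: A_def B_def C_def simplex)
    define k where "k = half_rel_entropy c"
    have edge_int: "(\<integral>p. f (A p) \<partial>unif3) = (\<integral>p. f (V p) \<partial>unif2)"
      "(\<integral>p. f (B p) \<partial>unif3) = (\<integral>p. f (V p) \<partial>unif2)"
      "(\<integral>p. f (C p) \<partial>unif3) = (\<integral>p. f (V p) \<partial>unif2)"
      if "(\<lambda>p. f (V p)) \<in> borel_measurable borel" for f :: "real^3 \<Rightarrow> real"
      using integral_unif3_edge[OF that] by (simp_all add: A_def B_def C_def)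
    have edge_integrable: "integrable unif3 (\<lambda>p. f (A p))" "integrable unif3 (\<lambda>p. f (B p))"
      "integrable unif3 (\<lambda>p. f (C p))" if "integrable unif2 (\<lambda>p. f (V p))" for f :: "real^3 \<Rightarrow> real"
      using integrable_unif3_edge[OF that] by (simp_all add: A_def B_def C_def)
    have k_meas: "(\<lambda>p. k (V p)) \<in> borel_measurable borel"
      unfolding k_def half_rel_entropy_def by measurable
    have k_int: "integrable unif2 (\<lambda>p. k (V p))" "(\<integral>p. k (V p) \<partial>unif2) = \<kappa>"
      using int by (simp_all add: k_def \<kappa>_def)
    have G_meas: "(\<lambda>p. triangle_grad c \<bullet> V p) \<in> borel_measurable borel"
      by measurable
    have G_int: "integrable unif2 (\<lambda>p. triangle_grad c \<bullet> V p)"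
      "(\<integral>p. triangle_grad c \<bullet> V p \<partial>unif2) = triangle_grad c \<bullet> m"
      using intV by (simp_all add: inner_vec_def m_def)
    define g where "g p = perm3 (A p) (B p) (C p) - 2 * (triangle_grad c \<bullet> (A p + B p + C p)) + 12 * ccc" for p
    have g_bound: "\<bar>g p\<bar> \<le> 2 * (k (A p) + k (B p) + k (C p))" for p
      unfolding g_def ccc_def k_def by (intro perm3_remainder_le simp3 pinsker c)
    have k3_int: "integrable unif3 (\<lambda>p. 2 * (k (A p) + k (B p) + k (C p)))"
      using edge_integrable[OF k_int(1)] by simp
    have g_int: "integrable unif3 g"
    proof (rule Bochner_Integration.integrable_bound[OF k3_int])
      show "g \<in> borel_measurable unif3"
        unfolding g_def
        by (intro borel_measurable_add borel_measurable_diff borel_measurable_times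
            borel_measurable_const borel_measurable_inner borel_measurable_perm3 meas)
      show "AE p in unif3. norm (g p) \<le> norm (2 * (k (A p) + k (B p) + k (C p)))"
        unfolding real_norm_def by (rule AE_I2) (rule order_trans[OF g_bound abs_ge_self])
    qed
    have "6 * t = (\<integral>p. perm3 (A p) (B p) (C p) \<partial>unif3)"
      unfolding t_def triangle_integral_eq_perm3[OF V simplex sym]
      by (simp add: A_def B_def C_def case_prod_unfold)
    also have "\<dots> = (\<integral>p. g p + 2 * (triangle_grad c \<bullet> A p + triangle_grad c \<bullet> B p + triangle_grad c \<bullet> C p) - 12 * ccc \<partial>unif3)"
      by (intro Bochner_Integration.integral_cong refl) (simp add: g_def inner_add_right)
    also have "\<dots> = (\<integral>p. g p \<partial>unif3) + 6 * (triangle_grad c \<bullet> m) - 12 * ccc"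
      using g_int edge_integrable[OF G_int(1)] edge_int[OF G_meas] G_int(2) unif3.prob_space by simp
    finally have "6 * R = (\<integral>p. g p \<partial>unif3)"
      by (simp add: R_def)
    also have "\<bar>\<dots>\<bar> \<le> (\<integral>p. \<bar>g p\<bar> \<partial>unif3)"
      by (rule integral_abs_bound)
    also have "\<dots> \<le> (\<integral>p. 2 * (k (A p) + k (B p) + k (C p)) \<partial>unif3)"
      using g_int k3_int g_bound by (intro integral_mono integrable_abs)
    also have "\<dots> = 6 * \<kappa>"
      using edge_integrable[OF k_int(1)] edge_int[OF k_meas] k_int(2) by simp
    finally show ?thesis .
  qed
  then have R: "\<bar>R\<bar> \<le> \<kappa>" by simp
  \<comment> \<open>By the Euler-Lagrange equation the cross-entropy cancels the linear terms of the
    objective; total mass 1 leaves only \<open>L\<close>.\<close>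
  have lnsum: "(\<Sum>a\<in>UNIV. m $ a * ln (c $ a)) =
      2 * (\<Sum>a\<in>UNIV. \<beta> $ a * m $ a) + 2 * \<beta>\<^sub>4 * (triangle_grad c \<bullet> m) - L * (m $ 1 + m $ 2 + m $ 3)"
    unfolding EL by (simp add: sum_3 inner_vec_def algebra_simps)
  have "T_functional \<beta> \<beta>\<^sub>4 W - 1 / 2 * I_functional W + \<kappa> =
      (\<Sum>a\<in>UNIV. \<beta> $ a * m $ a) + \<beta>\<^sub>4 * t - (\<Sum>a\<in>UNIV. m $ a * ln (c $ a)) / 2"
    unfolding T_functional_eq[OF V WV] I_functional_eq[OF V WV] \<kappa>
    by (simp add: m_def e_def t_def sum_subtractf diff_divide_distrib)
  then have "T_functional \<beta> \<beta>\<^sub>4 W - 1 / 2 * I_functional W - (L / 2 - 2 * \<beta>\<^sub>4 * ccc) + \<kappa> = \<beta>\<^sub>4 * R"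
    unfolding lnsum m by (simp add: R_def field_simps)
  then show ?bound
    using R by (simp add: \<kappa>_def ccc_def abs_mult mult_left_mono)
qed

section \<open>Cut distance from constant graphons\<close>

lemma distr_unif2_fst: "distr unif2 unif fst = unif"
proof (rule measure_eqI)
  fix A assume "A \<in> sets (distr unif2 unif fst)"
  then have A: "A \<in> sets unif" by simp
  have "fst -` A \<inter> space unif2 = A \<times> UNIV" by auto
  then show "emeasure (distr unif2 unif fst) A = emeasure unif A"
    using A unif.emeasure_space_1
    by (simp add: emeasure_distr unif.emeasure_pair_measure_Times)
qed simp

lemma AE_unif2_coordinates:
  assumes "AE x in unif. P x"
  shows "AE p in unif2. P (fst p)" "AE p in unif2. P (snd p)"
proof -
  show *: "AE p in unif2. P (fst p)"
    by (rule AE_distrD[where M' = unif], measurable, simp only: distr_unif2_fst assms)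
  show "AE p in unif2. P (snd p)"
    using AE_unif2_swap[OF *] by simp
qed

lemma emeasure_unif_eq_lebesgue_on:
  assumes "A \<in> sets borel"
  shows "emeasure unif A = emeasure (lebesgue_on unit_iv) (A \<inter> unit_iv)"
proof -
  have "emeasure unif A = emeasure lborel (A \<inter> unit_iv)"
    using assms by (simp add: unif_def emeasure_density indicator_inter_arith[symmetric] Int_commute)
  then show ?thesis
    using assms by (simp add: emeasure_restrict_space)
qed

text \<open>A measure-preserving bijection is only Lebesgue measurable, whereas image measures of
  \<open>unif\<close> call for a Borel map. The Borel version retains measure preservation, though
  not necessarily bijectivity.\<close>

lemma mp_bijection_borel_version:
  assumes \<phi>: "\<phi> \<in> mp_bijections"
  obtains \<psi> where "\<psi> \<in> borel_measurable borel" "AE x in unif. \<phi> x = \<psi> x" "distr unif unif \<psi> = unif"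
proof -
  let ?L = "lebesgue_on unit_iv"
  have meas: "\<phi> \<in> ?L \<rightarrow>\<^sub>M ?L" and mp: "distr ?L ?L \<phi> = ?L"
    using \<phi> by (auto simp: mp_bijections_def)
  have id: "(\<lambda>x. x) \<in> borel_measurable ?L"
    by (intro measurable_restrict_space1 measurable_completion) simp
  have "\<phi> \<in> borel_measurable ?L"
    using measurable_compose[OF meas id] .
  then have "(\<lambda>x. if x \<in> unit_iv then \<phi> x else 0) \<in> borel_measurable lebesgue"
    by (intro borel_measurable_if_I) auto
  from completion_ex_borel_measurable_real[OF this]
  obtain \<psi> where \<psi>: "\<psi> \<in> borel_measurable lborel"
      "AE x in lborel. (if x \<in> unit_iv then \<phi> x else 0) = \<psi> x"
    by blast
  have "AE x in lborel. 0 < (indicator unit_iv x :: ennreal) \<longrightarrow> \<phi> x = \<psi> x"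
    using \<psi>(2)
  proof eventually_elim
    case (elim x)
    then show ?case by (cases "x \<in> unit_iv") (simp_all del: atLeastAtMost_iff)
  qed
  then have eq: "AE x in unif. \<phi> x = \<psi> x"
    unfolding unif_def by (subst AE_density) simp_all
  have maps: "\<phi> x \<in> unit_iv" if "x \<in> unit_iv" for x
    using \<phi> that unfolding mp_bijections_def bij_betw_def by blast
  have \<psi>b [measurable]: "\<psi> \<in> borel_measurable borel"
    using \<psi>(1) by simp
  have "distr unif unif \<psi> = unif"
  proof (rule measure_eqI)
    fix A assume "A \<in> sets (distr unif unif \<psi>)"
    then have A [measurable]: "A \<in> sets borel" by simp
    have pre: "\<psi> -` A \<in> sets borel"
      using measurable_sets[OF \<psi>b A] by simp
    have AI: "A \<inter> unit_iv \<in> sets ?L"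
      using A by (simp add: sets_restrict_space_iff)
    have eqL: "AE x in ?L. \<phi> x = \<psi> x"
      unfolding AE_lebesgue_on_iff[OF atLeastAtMost_borel] unif_def[symmetric] by (rule eq)
    have "emeasure (distr unif unif \<psi>) A = emeasure unif (\<psi> -` A)"
      using A by (simp add: emeasure_distr)
    also have "\<dots> = emeasure ?L (\<psi> -` A \<inter> unit_iv)"
      by (rule emeasure_unif_eq_lebesgue_on[OF pre])
    \<comment> \<open>Over Lebesgue measure \<open>\<psi>\<close> may be exchanged for
      \<open>\<phi>\<close>, whose image measure is known.\<close>
    also have "\<dots> = emeasure ?L (\<phi> -` (A \<inter> unit_iv) \<inter> space ?L)"
    proof (rule emeasure_eq_AE)
      show "AE x in ?L. x \<in> \<psi> -` A \<inter> unit_iv \<longleftrightarrow> x \<in> \<phi> -` (A \<inter> unit_iv) \<inter> space ?L"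
        using eqL AE_space[of ?L]
      proof eventually_elim
        case (elim x)
        then have "x \<in> unit_iv" by (simp add: space_restrict_space)
        with elim(1) maps[OF this] show ?case by (simp add: space_restrict_space)
      qed
      show "\<psi> -` A \<inter> unit_iv \<in> sets ?L"
        using pre by (simp add: sets_restrict_space_iff)
    qed (rule measurable_sets[OF meas AI])
    also have "\<dots> = emeasure (distr ?L ?L \<phi>) (A \<inter> unit_iv)"
      by (rule emeasure_distr[OF meas AI, symmetric])
    also have "\<dots> = emeasure unif A"
      by (simp add: mp emeasure_unif_eq_lebesgue_on)
    finally show "emeasure (distr unif unif \<psi>) A = emeasure unif A" .
  qed simp
  with \<psi>b eq show thesis by (rule that)
qed

lemma distr_unif2_prod:
  assumes \<psi>: "\<psi> \<in> borel_measurable borel" "distr unif unif \<psi> = unif"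
  shows "distr unif2 unif2 (\<lambda>p. (\<psi> (fst p), \<psi> (snd p))) = unif2"
proof -
  have [measurable]: "\<psi> \<in> unif \<rightarrow>\<^sub>M unif" using \<psi>(1) by measurable
  have "distr unif unif \<psi> \<Otimes>\<^sub>M distr unif unif \<psi> = distr unif2 unif2 (\<lambda>(x, y). (\<psi> x, \<psi> y))"
    by (intro pair_measure_distr) (simp_all add: \<psi> unif.sigma_finite_measure_axioms)
  then show ?thesis by (simp add: \<psi> case_prod_unfold)
qed

section \<open>Bounds for the cut norm and the cut distance\<close>

lemma cut_norm_bdd_above:
  fixes U :: "real \<times> real \<Rightarrow> real"
  assumes "\<And>p. p \<in> unit_iv \<times> unit_iv \<Longrightarrow> \<bar>U p\<bar> \<le> 1"
  shows "bdd_above ((\<lambda>(S, T). \<bar>LINT p:S \<times> T|lebesgue. U p\<bar>) `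
    {(S, T). S \<in> sets lebesgue \<and> T \<in> sets lebesgue \<and> S \<subseteq> unit_iv \<and> T \<subseteq> unit_iv})"
proof -
  let ?B = "\<integral>p. indicator (unit_iv \<times> unit_iv) p \<partial>(lebesgue :: (real \<times> real) measure) :: real"
  have "unit_iv \<times> unit_iv \<in> lmeasurable"
    by (intro lmeasurable_compact compact_Times) auto
  then have intB: "integrable lebesgue (indicator (unit_iv \<times> unit_iv) :: real \<times> real \<Rightarrow> real)"
    by (simp add: lmeasurable_iff_integrable)
  have "\<bar>LINT p:S \<times> T|lebesgue. U p\<bar> \<le> ?B" if "S \<subseteq> unit_iv" "T \<subseteq> unit_iv" for S T
  proof (cases "integrable lebesgue (\<lambda>p. indicator (S \<times> T) p *\<^sub>R U p)")
    case True
    have "\<bar>LINT p:S \<times> T|lebesgue. U p\<bar> \<le> (\<integral>p. \<bar>indicator (S \<times> T) p *\<^sub>R U p\<bar> \<partial>lebesgue)"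
      unfolding set_lebesgue_integral_def by (rule integral_abs_bound)
    also have "\<dots> \<le> ?B"
    proof (rule integral_mono[OF integrable_abs[OF True] intB])
      show "\<bar>indicator (S \<times> T) p *\<^sub>R U p\<bar> \<le> indicator (unit_iv \<times> unit_iv) p" for p
      proof (cases "p \<in> S \<times> T")
        case True
        then have "p \<in> unit_iv \<times> unit_iv" using that by blast
        with assms[OF this] True show ?thesis by simp
      qed simp
    qed
    finally show ?thesis .
  next
    \<comment> \<open>The integral of a non-integrable function is 0 by convention, so the bound is
      trivial here.\<close>
    case False
    then show ?thesis
      by (simp add: set_lebesgue_integral_def not_integrable_integral_eq integral_nonneg_AE)
  qed
  then show ?thesis by (intro bdd_aboveI[of _ ?B]) auto
qed

lemma cut_norm_ge:
  assumes "\<And>p. p \<in> unit_iv \<times> unit_iv \<Longrightarrow> \<bar>U p\<bar> \<le> 1"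
    and "S \<in> sets lebesgue" "T \<in> sets lebesgue" "S \<subseteq> unit_iv" "T \<subseteq> unit_iv"
  shows "\<bar>LINT p:S \<times> T|lebesgue. U p\<bar> \<le> cut_norm U"
  unfolding cut_norm_def using assms
  by (intro cSUP_upper2[OF cut_norm_bdd_above[of U], of "(S, T)"]) auto

lemma cut_norm_nonneg:
  assumes "\<And>p. p \<in> unit_iv \<times> unit_iv \<Longrightarrow> \<bar>U p\<bar> \<le> 1"
  shows "0 \<le> cut_norm U"
  using cut_norm_ge[of U "{}" "{}"] assms by simp

lemma cut_norm_test:
  assumes bound: "\<And>p. p \<in> unit_iv \<times> unit_iv \<Longrightarrow> \<bar>U p\<bar> \<le> 1"
    and ST: "S \<in> sets lebesgue" "T \<in> sets lebesgue" "S \<subseteq> unit_iv" "T \<subseteq> unit_iv"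
    and f: "f \<in> borel_measurable borel" "AE p in unif2. indicator (S \<times> T) p * U p = f p"
  shows "\<bar>\<integral>p. f p \<partial>unif2\<bar> \<le> cut_norm U"
proof -
  have "(LINT p:S \<times> T|lebesgue. U p) = (LINT p:unit_iv \<times> unit_iv|lebesgue. indicator (S \<times> T) p * U p)"
    unfolding set_lebesgue_integral_def using ST(3,4)
    by (intro Bochner_Integration.integral_cong refl) (auto simp: indicator_def)
  also have "\<dots> = (\<integral>p. f p \<partial>unif2)"
    by (intro set_integral_square sets_square f)
  finally have "(LINT p:S \<times> T|lebesgue. U p) = (\<integral>p. f p \<partial>unif2)" .
  moreover have "\<bar>LINT p:S \<times> T|lebesgue. U p\<bar> \<le> cut_norm U"
    using bound ST by (rule cut_norm_ge)
  ultimately show ?thesis by simp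
qed

lemma cut_norm3_test:
  assumes bound: "\<And>p a. p \<in> unit_iv \<times> unit_iv \<Longrightarrow> \<bar>U p $ a\<bar> \<le> 1"
    and ST: "S \<in> sets lebesgue" "T \<in> sets lebesgue" "S \<subseteq> unit_iv" "T \<subseteq> unit_iv"
    and f: "f \<in> borel_measurable borel" "AE p in unif2. indicator (S \<times> T) p * U p $ a = f p"
  shows "\<bar>\<integral>p. f p \<partial>unif2\<bar> \<le> cut_norm3 U"
proof -
  have "\<bar>\<integral>p. f p \<partial>unif2\<bar> \<le> cut_norm (\<lambda>p. U p $ a)"
    by (rule cut_norm_test[OF bound ST f])
  also have "\<dots> \<le> cut_norm3 U"
    unfolding cut_norm3_def using bound by (intro member_le_sum cut_norm_nonneg) auto
  finally show ?thesis .
qed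

lemma mp_bijections_maps: "\<phi> \<in> mp_bijections \<Longrightarrow> x \<in> unit_iv \<Longrightarrow> \<phi> x \<in> unit_iv"
  unfolding mp_bijections_def bij_betw_def by blast

lemma id_mp_bijections: "(\<lambda>x. x) \<in> mp_bijections"
  by (simp add: mp_bijections_def bij_betw_def distr_id2)

lemma graphon3_diff_bound:
  assumes U: "U \<in> graphons3" and W: "W \<in> graphons3" and \<phi>: "\<phi> \<in> mp_bijections"
    and p: "p \<in> unit_iv \<times> unit_iv"
  shows "\<bar>(U p - relabel \<phi> W p) $ a\<bar> \<le> 1"
proof -
  have "U p \<in> simplex3"
    using U p unfolding graphons3_def by blast
  moreover have "relabel \<phi> W p \<in> simplex3"
    using W p mp_bijections_maps[OF \<phi>] unfolding graphons3_def relabel_def by fastforce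
  ultimately have "0 \<le> U p $ a" "U p $ a \<le> 1" "0 \<le> relabel \<phi> W p $ a" "relabel \<phi> W p $ a \<le> 1"
    using simplex3_bounds by blast+
  then show ?thesis
    unfolding vector_minus_component abs_le_iff by linarith
qed

lemma cut_norm3_relabel_nonneg:
  assumes "U \<in> graphons3" "W \<in> graphons3" "\<phi> \<in> mp_bijections"
  shows "0 \<le> cut_norm3 (\<lambda>p. U p - relabel \<phi> W p)"
  unfolding cut_norm3_def using graphon3_diff_bound[OF assms]
  by (intro sum_nonneg cut_norm_nonneg) auto

text \<open>A lower bound uniform in the relabeling passes to the infimum, whether or not it is
  attained; the identity shows that the infimum is over a nonempty set.\<close>

lemma cut_dist3_eq_0_imp_le:
  assumes "cut_dist3 U W = 0" and "\<And>\<phi>. \<phi> \<in> mp_bijections \<Longrightarrow> r \<le> cut_norm3 (\<lambda>p. U p - relabel \<phi> W p)"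
  shows "r \<le> 0"
proof -
  have "r \<le> cut_dist3 U W"
    unfolding cut_dist3_def using id_mp_bijections assms(2) by (intro cINF_greatest) auto
  with assms(1) show ?thesis by simp
qed

text \<open>The exceptional null set of \<open>W\<close> is pulled back along \<open>\<psi>\<close>
  acting on both coordinates, which preserves the measure; only then is \<open>\<psi>\<close>
  replaced by \<open>\<phi>\<close>.\<close>

lemma AE_relabel:
  assumes WV: "AE p in unif2. W p = V p" and \<phi>: "AE x in unif. \<phi> x = \<psi> x"
    and \<psi>: "\<psi> \<in> borel_measurable borel" "distr unif unif \<psi> = unif"
  shows "AE p in unif2. relabel \<phi> W p = V (\<psi> (fst p), \<psi> (snd p))"
proof -
  have [measurable]: "\<psi> \<in> unif \<rightarrow>\<^sub>M unif" using \<psi>(1) by measurable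
  have "AE p in unif2. W (\<psi> (fst p), \<psi> (snd p)) = V (\<psi> (fst p), \<psi> (snd p))"
    by (rule AE_distrD[where M' = unif2 and P = "\<lambda>p. W p = V p"], measurable,
        simp only: distr_unif2_prod[OF \<psi>] WV)
  with AE_unif2_coordinates[OF \<phi>] show ?thesis
    by eventually_elim (simp add: relabel_def case_prod_unfold)
qed

section \<open>Integrals over rectangles determine a function\<close>

text \<open>The measure with constant density \<open>r\<close> is written as a product, because a
  product measure is determined by its values on rectangles.\<close>

lemma density_rectangle:
  fixes f :: "real \<times> real \<Rightarrow> real"
  assumes f: "f \<in> borel_measurable borel" "\<And>p. 0 \<le> f p" "\<And>p. f p \<le> 1" and r: "0 \<le> r"
    and eq: "\<And>S T. S \<in> sets borel \<Longrightarrow> T \<in> sets borel \<Longrightarrow> (\<integral>p. indicator (S \<times> T) p * (f p - r) \<partial>unif2) = 0"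
  shows "unif \<Otimes>\<^sub>M density unif (\<lambda>_. ennreal r) = density unif2 (\<lambda>p. ennreal (f p))"
proof (rule pair_measure_eqI)
  show "sigma_finite_measure unif" ..
  have "finite_measure (density unif (\<lambda>_. ennreal r))"
    by (intro finite_measureI) (simp add: emeasure_density_const unif.emeasure_eq_measure ennreal_mult_eq_top_iff)
  then show "sigma_finite_measure (density unif (\<lambda>_. ennreal r))"
    by (rule finite_measure.axioms)
  show "sets (unif \<Otimes>\<^sub>M density unif (\<lambda>_. ennreal r)) = sets (density unif2 (\<lambda>p. ennreal (f p)))"
    by (simp cong: sets_pair_measure_cong)
  fix S T assume "S \<in> sets unif" "T \<in> sets (density unif (\<lambda>_. ennreal r))"
  then have ST: "S \<in> sets borel" "T \<in> sets borel" by auto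
  then have ST2 [measurable]: "S \<times> T \<in> sets unif2" by auto
  note [measurable] = f(1)[THEN borel_measurable_unif2]
  have int: "integrable unif2 (\<lambda>p. indicator (S \<times> T) p * f p)"
    using f by (intro unif2.integrable_const_bound[of _ 1]) (auto simp: indicator_def)
  have int': "integrable unif2 (\<lambda>p. indicator (S \<times> T) p * r)"
    using r by (intro unif2.integrable_const_bound[of _ r]) (auto simp: indicator_def)
  have "(\<integral>p. indicator (S \<times> T) p * f p \<partial>unif2) = r * measure unif2 (S \<times> T)"
    using eq[OF ST] int int' by (simp add: right_diff_distrib)
  then have "ennreal (r * measure unif2 (S \<times> T)) = (\<integral>\<^sup>+p. ennreal (indicator (S \<times> T) p * f p) \<partial>unif2)"
    using nn_integral_eq_integral[OF int] f(2) by simp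
  also have "\<dots> = (\<integral>\<^sup>+p. ennreal (f p) * indicator (S \<times> T) p \<partial>unif2)"
    by (intro nn_integral_cong) (simp add: indicator_def)
  also have "\<dots> = emeasure (density unif2 (\<lambda>p. ennreal (f p))) (S \<times> T)"
    by (intro emeasure_density[symmetric]) measurable
  finally have "emeasure (density unif2 (\<lambda>p. ennreal (f p))) (S \<times> T) = ennreal r * emeasure unif2 (S \<times> T)"
    using r by (simp only: unif2.emeasure_eq_measure ennreal_mult measure_nonneg)
  also have "emeasure unif2 (S \<times> T) = emeasure unif S * emeasure unif T"
    using ST by (intro unif.emeasure_pair_measure_Times) auto
  also have "ennreal r * \<dots> = emeasure unif S * emeasure (density unif (\<lambda>_. ennreal r)) T"
    using ST by (simp only: emeasure_density_const sets_unif mult.left_commute)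
  finally show "emeasure unif S * emeasure (density unif (\<lambda>_. ennreal r)) T =
      emeasure (density unif2 (\<lambda>p. ennreal (f p))) (S \<times> T)" by simp
qed

text \<open>Both \<open>f\<close> and the constant \<open>r\<close> are densities of the same
  product measure, and densities are unique almost everywhere.\<close>

lemma AE_eq_const_if_rectangle_integrals:
  fixes f :: "real \<times> real \<Rightarrow> real"
  assumes f: "f \<in> borel_measurable borel" "\<And>p. 0 \<le> f p" "\<And>p. f p \<le> 1" and r: "0 \<le> r" "r \<le> 1"
    and eq: "\<And>S T. S \<in> sets borel \<Longrightarrow> T \<in> sets borel \<Longrightarrow> (\<integral>p. indicator (S \<times> T) p * (f p - r) \<partial>unif2) = 0"
  shows "AE p in unif2. f p = r"
proof -
  note [measurable] = f(1)[THEN borel_measurable_unif2]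
  have "density unif2 (\<lambda>p. ennreal (f p)) = unif \<Otimes>\<^sub>M density unif (\<lambda>_. ennreal r)"
    by (rule density_rectangle[OF f r(1) eq, symmetric])
  also have "\<dots> = density unif2 (\<lambda>_. ennreal r)"
    by (rule density_rectangle) (simp_all add: r)
  finally have "density unif2 (\<lambda>p. ennreal (f p)) = density unif2 (\<lambda>_. ennreal r)" .
  then have "AE p in unif2. ennreal (f p) = ennreal r"
    by (rule unif2.density_unique[rotated 2]) measurable
  then show ?thesis
    by eventually_elim (simp add: f(2) r)
qed

lemma AE_eq_simplex3_if_rectangle_integrals:
  assumes X: "X \<in> borel_measurable borel" "\<And>p. X p \<in> simplex3" and c: "c \<in> simplex3"
    and test: "\<And>S T a. S \<in> sets borel \<Longrightarrow> T \<in> sets borel \<Longrightarrow>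
      \<bar>\<integral>p. indicator (S \<times> T) p * (X p $ a - c $ a) \<partial>unif2\<bar> \<le> 0"
  shows "AE p in unif2. X p = c"
proof -
  have "AE p in unif2. X p $ a = c $ a" for a
  proof (rule AE_eq_const_if_rectangle_integrals)
    show "(\<lambda>p. X p $ a) \<in> borel_measurable borel"
      by (rule borel_measurable_component[OF X(1)])
    fix S T :: "real set"
    assume "S \<in> sets borel" "T \<in> sets borel"
    then show "(\<integral>p. indicator (S \<times> T) p * (X p $ a - c $ a) \<partial>unif2) = 0"
      using test[of S T a] by (simp only: abs_le_zero_iff)
  qed (rule simplex3_bounds X c)+
  then have "AE p in unif2. \<forall>a\<in>UNIV. X p $ a = c $ a"
    by (intro AE_finite_allI) auto
  then show ?thesis
    by eventually_elim (simp add: vec_eq_iff)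
qed

lemma mp_bijection_vimage:
  assumes \<phi>: "\<phi> \<in> mp_bijections" and A: "A \<in> sets borel"
  shows "{x \<in> unit_iv. \<phi> x \<in> A} \<in> sets lebesgue"
proof -
  have "\<phi> -` (A \<inter> unit_iv) \<inter> space (lebesgue_on unit_iv) \<in> sets (lebesgue_on unit_iv)"
  proof (rule measurable_sets)
    show "\<phi> \<in> lebesgue_on unit_iv \<rightarrow>\<^sub>M lebesgue_on unit_iv"
      using \<phi> by (simp add: mp_bijections_def)
    show "A \<inter> unit_iv \<in> sets (lebesgue_on unit_iv)"
      using A by (simp add: sets_restrict_space_iff)
  qed
  moreover have "\<phi> -` (A \<inter> unit_iv) \<inter> space (lebesgue_on unit_iv) = {x \<in> unit_iv. \<phi> x \<in> A}"
    using mp_bijections_maps[OF \<phi>] unfolding space_lebesgue_on by blast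
  ultimately show ?thesis by (simp add: sets_restrict_space_iff)
qed

text \<open>Every relabeling of a constant is the same constant almost everywhere, so the rectangle
  itself, clipped to the unit square, is the test set.\<close>

lemma rectangle_integral_le_cut_norm3:
  assumes U: "U \<in> graphons3" and W: "W \<in> graphons3" and \<phi>: "\<phi> \<in> mp_bijections"
    and V: "V \<in> borel_measurable borel" "AE p in unif2. U p = V p" and Wc: "AE p in unif2. W p = c"
    and ST: "S \<in> sets borel" "T \<in> sets borel"
  shows "\<bar>\<integral>p. indicator (S \<times> T) p * (V p $ a - c $ a) \<partial>unif2\<bar> \<le> cut_norm3 (\<lambda>p. U p - relabel \<phi> W p)"
proof (rule cut_norm3_test[OF graphon3_diff_bound[OF U W \<phi>]])
  show "(\<lambda>p. indicator (S \<times> T) p * (V p $ a - c $ a)) \<in> borel_measurable borel"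
    by (intro borel_measurable_times borel_measurable_indicator borel_Times ST borel_measurable_diff
        borel_measurable_component V borel_measurable_const)
  obtain \<psi> where \<psi>: "\<psi> \<in> borel_measurable borel" "AE x in unif. \<phi> x = \<psi> x" "distr unif unif \<psi> = unif"
    using mp_bijection_borel_version[OF \<phi>] by blast
  show "AE p in unif2. indicator ((S \<inter> unit_iv) \<times> (T \<inter> unit_iv)) p * (U p - relabel \<phi> W p) $ a =
      indicator (S \<times> T) p * (V p $ a - c $ a)"
    using V(2) AE_relabel[OF Wc \<psi>(2,1,3)] AE_unif2_square
  proof eventually_elim
    case (elim p)
    have "p \<in> (S \<inter> unit_iv) \<times> (T \<inter> unit_iv) \<longleftrightarrow> p \<in> S \<times> T"
      using elim(3) by blast
    then have "indicator ((S \<inter> unit_iv) \<times> (T \<inter> unit_iv)) p = (indicator (S \<times> T) p :: real)"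
      by (simp only: indicator_def)
    then show ?case
      by (simp only: elim vector_minus_component)
  qed
qed (use ST in simp_all)

text \<open>Here the relabeled graphon is the one under test, so the rectangle is pulled back along
  \<open>\<phi>\<close>, and measure preservation undoes the change of variables.\<close>

lemma relabelled_rectangle_integral_le_cut_norm3:
  assumes U: "U \<in> graphons3" and W: "W \<in> graphons3" and \<phi>: "\<phi> \<in> mp_bijections"
    and V: "V \<in> borel_measurable borel" "AE p in unif2. W p = V p" and Uc: "AE p in unif2. U p = c"
    and ST: "S \<in> sets borel" "T \<in> sets borel"
  shows "\<bar>\<integral>p. indicator (S \<times> T) p * (V p $ a - c $ a) \<partial>unif2\<bar> \<le> cut_norm3 (\<lambda>p. U p - relabel \<phi> W p)"
proof -
  obtain \<psi> where \<psi>: "\<psi> \<in> borel_measurable borel" "AE x in unif. \<phi> x = \<psi> x" "distr unif unif \<psi> = unif"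
    using mp_bijection_borel_version[OF \<phi>] by blast
  define \<Psi> where "\<Psi> p = (\<psi> (fst p), \<psi> (snd p))" for p :: "real \<times> real"
  have [measurable]: "\<psi> \<in> unif \<rightarrow>\<^sub>M unif"
    using \<psi>(1) by measurable
  have \<Psi>2: "\<Psi> \<in> unif2 \<rightarrow>\<^sub>M unif2"
    unfolding \<Psi>_def by measurable
  then have \<Psi>: "\<Psi> \<in> borel_measurable borel"
    by (simp only: measurable_cong_sets[OF sets_unif2 sets_unif2])
  define g where "g p = indicator (S \<times> T) p * (V p $ a - c $ a)" for p
  have g: "g \<in> borel_measurable borel"
    unfolding g_def
    by (intro borel_measurable_times borel_measurable_indicator borel_Times ST borel_measurable_diff
        borel_measurable_component V borel_measurable_const)
  define pre where "pre A = {x \<in> unit_iv. \<phi> x \<in> A}" for A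
  \<comment> \<open>The sign appears because the graphon under test is the one subtracted in the cut
    norm.\<close>
  have "\<bar>\<integral>p. - g (\<Psi> p) \<partial>unif2\<bar> \<le> cut_norm3 (\<lambda>p. U p - relabel \<phi> W p)"
  proof (rule cut_norm3_test[OF graphon3_diff_bound[OF U W \<phi>]])
    show "(\<lambda>p. - g (\<Psi> p)) \<in> borel_measurable borel"
      by (intro borel_measurable_uminus measurable_compose[OF \<Psi> g])
    show "pre S \<in> sets lebesgue" "pre T \<in> sets lebesgue"
      unfolding pre_def by (rule mp_bijection_vimage[OF \<phi>], rule ST)+
    show "pre S \<subseteq> unit_iv" "pre T \<subseteq> unit_iv"
      by (auto simp: pre_def)
    show "AE p in unif2. indicator (pre S \<times> pre T) p * (U p - relabel \<phi> W p) $ a = - g (\<Psi> p)"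
      using Uc AE_relabel[OF V(2) \<psi>(2,1,3)] AE_unif2_coordinates[OF \<psi>(2)] AE_unif2_square
    proof eventually_elim
      case (elim p)
      have "fst p \<in> unit_iv" "snd p \<in> unit_iv"
        using elim(5) by (auto simp: mem_Times_iff)
      then have "p \<in> pre S \<times> pre T \<longleftrightarrow> \<Psi> p \<in> S \<times> T"
        unfolding pre_def \<Psi>_def mem_Times_iff using elim(3,4) by simp
      then have "indicator (pre S \<times> pre T) p = (indicator (S \<times> T) (\<Psi> p) :: real)"
        by (simp only: indicator_def)
      moreover have "relabel \<phi> W p = V (\<Psi> p)"
        using elim(2) by (simp only: \<Psi>_def)
      ultimately show ?case
        by (simp only: g_def vector_minus_component elim(1)) (simp only: right_diff_distrib minus_diff_eq)
    qed
  qed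
  moreover have "(\<integral>p. g (\<Psi> p) \<partial>unif2) = (\<integral>p. g p \<partial>unif2)"
    using integral_distr[OF \<Psi>2 borel_measurable_unif2[OF g]] distr_unif2_prod[OF \<psi>(1,3)]
    unfolding \<Psi>_def by (simp only:)
  ultimately show ?thesis
    by (simp only: g_def integral_minus abs_minus_cancel)
qed

text \<open>Relabeling acts on the second argument only, so the two directions are proved
  separately, each by testing with rectangles.\<close>

lemma cut_dist3_zero_const:
  assumes U: "U \<in> graphons3" and W: "W \<in> graphons3" and dist: "cut_dist3 U W = 0" and c: "c \<in> simplex3"
  shows "(AE p in unif2. U p = c) \<longleftrightarrow> (AE p in unif2. W p = c)"
proof
  assume Uc: "AE p in unif2. U p = c"
  obtain V where V: "V \<in> borel_measurable borel" "\<And>p. V p \<in> simplex3"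
    "\<And>x y. V (x, y) = V (y, x)" "AE p in unif2. W p = V p"
    by (rule graphon3_borel_version[OF W], rule that)
  have "AE p in unif2. V p = c"
  proof (rule AE_eq_simplex3_if_rectangle_integrals[OF V(1,2) c])
    show "\<bar>\<integral>p. indicator (S \<times> T) p * (V p $ a - c $ a) \<partial>unif2\<bar> \<le> 0"
      if ST: "S \<in> sets borel" "T \<in> sets borel" for S T a
      by (rule cut_dist3_eq_0_imp_le[OF dist])
        (rule relabelled_rectangle_integral_le_cut_norm3[OF U W _ V(1,4) Uc ST])
  qed
  with V(4) show "AE p in unif2. W p = c" by eventually_elim simp
next
  assume Wc: "AE p in unif2. W p = c"
  obtain V where V: "V \<in> borel_measurable borel" "\<And>p. V p \<in> simplex3"
    "\<And>x y. V (x, y) = V (y, x)" "AE p in unif2. U p = V p"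
    by (rule graphon3_borel_version[OF U], rule that)
  have "AE p in unif2. V p = c"
  proof (rule AE_eq_simplex3_if_rectangle_integrals[OF V(1,2) c])
    show "\<bar>\<integral>p. indicator (S \<times> T) p * (V p $ a - c $ a) \<partial>unif2\<bar> \<le> 0"
      if ST: "S \<in> sets borel" "T \<in> sets borel" for S T a
      by (rule cut_dist3_eq_0_imp_le[OF dist])
        (rule rectangle_integral_le_cut_norm3[OF U W _ V(1,4) Wc ST])
  qed
  with V(4) show "AE p in unif2. U p = c" by eventually_elim simp
qed

lemma cut_norm3_AE_zero:
  assumes "AE p in unif2. U p = 0"
  shows "cut_norm3 U = 0"
proof -
  have "(LINT p:S \<times> T|lebesgue. U p $ a) = 0" if ST: "S \<subseteq> unit_iv" "T \<subseteq> unit_iv" for S T a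
  proof -
    have "(LINT p:S \<times> T|lebesgue. U p $ a) = (LINT p:unit_iv \<times> unit_iv|lebesgue. indicator (S \<times> T) p * U p $ a)"
      unfolding set_lebesgue_integral_def
    proof (rule Bochner_Integration.integral_cong[OF refl])
      show "indicator (S \<times> T) p *\<^sub>R U p $ a =
          indicator (unit_iv \<times> unit_iv) p *\<^sub>R (indicator (S \<times> T) p * U p $ a)" for p
      proof (cases "p \<in> S \<times> T")
        case True
        then have "p \<in> unit_iv \<times> unit_iv" using ST by blast
        with True show ?thesis by (simp only: indicator_simps) simp
      next
        case False
        then show ?thesis by simp
      qed
    qed
    also have "\<dots> = (\<integral>p. 0 \<partial>unif2)"
    proof (intro set_integral_square sets_square)
      show "AE p in unif2. indicator (S \<times> T) p * U p $ a = 0"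
        using assms by eventually_elim simp
    qed simp
    finally show ?thesis by simp
  qed
  then have "cut_norm (\<lambda>p. U p $ a) = (SUP _ \<in> {(S, T). S \<in> sets lebesgue \<and> T \<in> sets lebesgue \<and> S \<subseteq> unit_iv \<and> T \<subseteq> unit_iv}. 0)" for a
    unfolding cut_norm_def by (intro SUP_cong refl) clarsimp
  moreover have "({}, {}) \<in> {(S, T). S \<in> sets lebesgue \<and> T \<in> sets lebesgue \<and> S \<subseteq> unit_iv \<and> T \<subseteq> unit_iv}"
    by simp
  ultimately have "cut_norm (\<lambda>p. U p $ a) = 0" for a
    by (simp only: image_constant cSup_singleton)
  then show ?thesis
    by (simp add: cut_norm3_def)
qed

text \<open>The identity relabeling already attains 0, and no relabeling gives a negative
  value.\<close>

lemma cut_dist3_zero_if_AE_eq: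
  assumes "U \<in> graphons3" "W \<in> graphons3" and eq: "AE p in unif2. U p = W p"
  shows "cut_dist3 U W = 0"
proof (rule antisym)
  let ?d = "\<lambda>\<phi>. cut_norm3 (\<lambda>p. U p - relabel \<phi> W p)"
  have "AE p in unif2. U p - relabel (\<lambda>x. x) W p = 0"
    using eq by eventually_elim (simp add: relabel_def)
  then have "?d (\<lambda>x. x) = 0"
    by (rule cut_norm3_AE_zero)
  moreover have "bdd_below (?d ` mp_bijections)"
    using cut_norm3_relabel_nonneg[OF assms(1,2)] by (intro bdd_belowI2)
  ultimately show "cut_dist3 U W \<le> 0"
    unfolding cut_dist3_def using cINF_lower[OF _ id_mp_bijections, of ?d] by simp
  show "0 \<le> cut_dist3 U W"
    unfolding cut_dist3_def using id_mp_bijections cut_norm3_relabel_nonneg[OF assms(1,2)]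
    by (intro cINF_greatest) auto
qed

section \<open>Existence, uniqueness and constancy of the maximizer\<close>

theorem corollary3p37:
  fixes \<beta> :: "real^3" and \<beta>\<^sub>4 :: real
  assumes "\<bar>\<beta>\<^sub>4\<bar> < 1"
  shows "(\<exists>!C. is_maximizer \<beta> \<beta>\<^sub>4 C) \<and>
         (\<forall>C. is_maximizer \<beta> \<beta>\<^sub>4 C \<longrightarrow> (\<forall>W \<in> C. constant_graphon3 W))"
proof -
  obtain c L where c: "c \<in> simplex3" "\<And>a. 0 < c $ a"
    and EL: "\<And>a. ln (c $ a) = 2 * \<beta> $ a + 2 * \<beta>\<^sub>4 * triangle_grad c $ a - L"
    using euler_lagrange_solution by blast
  define F where "F W = T_functional \<beta> \<beta>\<^sub>4 W - 1 / 2 * I_functional W" for W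
  define M where "M = L / 2 - 2 * \<beta>\<^sub>4 * (c $ 1 * c $ 2 * c $ 3)"
  \<comment> \<open>This set turns out to be the maximizing class, and \<open>M\<close> is the value
    of the objective on it.\<close>
  define Cc where "Cc = {W \<in> graphons3. AE p in unif2. W p = c}"
  have F: "F W \<le> M" "F W = M \<longleftrightarrow> W \<in> Cc" if W: "W \<in> graphons3" for W
  proof -
    obtain V where V: "V \<in> borel_measurable borel" "\<And>p. V p \<in> simplex3"
      "\<And>x y. V (x, y) = V (y, x)" "AE p in unif2. W p = V p"
      by (rule graphon3_borel_version[OF W], rule that)
    define \<kappa> where "\<kappa> = (\<integral>p. half_rel_entropy c (V p) \<partial>unif2)"
    have int: "integrable unif2 (\<lambda>p. half_rel_entropy c (V p))"
      and bound: "\<bar>F W - M + \<kappa>\<bar> \<le> \<bar>\<beta>\<^sub>4\<bar> * \<kappa>"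
      using objective_expansion[OF V c EL] by (simp_all only: F_def M_def \<kappa>_def)
    have dev: "(V p $ a - c $ a)\<^sup>2 \<le> half_rel_entropy c (V p)" for p a
      by (rule pinsker[OF V(2) c])
    have nonneg: "0 \<le> half_rel_entropy c (V p)" for p
      using dev[of p 1] zero_le_power2 order_trans by blast
    then have \<kappa>0: "0 \<le> \<kappa>"
      unfolding \<kappa>_def by (rule integral_nonneg_AE[OF AE_I2])
    have zero: "half_rel_entropy c (V p) = 0 \<longleftrightarrow> V p = c" for p
    proof
      assume "half_rel_entropy c (V p) = 0"
      then have "V p $ a = c $ a" for a using dev[of p a] by simp
      then show "V p = c" by (simp add: vec_eq_iff)
    qed simp
    have "\<kappa> = 0 \<longleftrightarrow> (AE p in unif2. V p = c)"
      unfolding \<kappa>_def using integral_nonneg_eq_0_iff_AE[OF int AE_I2[OF nonneg]] by (simp only: zero)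
    also have "\<dots> \<longleftrightarrow> (AE p in unif2. W p = c)"
    proof
      assume "AE p in unif2. V p = c"
      with V(4) show "AE p in unif2. W p = c" by eventually_elim simp
    next
      assume "AE p in unif2. W p = c"
      with V(4) show "AE p in unif2. V p = c" by eventually_elim simp
    qed
    finally have \<kappa>c: "\<kappa> = 0 \<longleftrightarrow> W \<in> Cc"
      using W by (simp add: Cc_def)
    have gap: "F W - M \<le> - ((1 - \<bar>\<beta>\<^sub>4\<bar>) * \<kappa>)"
      using bound unfolding left_diff_distrib abs_le_iff by linarith
    have pos: "0 \<le> (1 - \<bar>\<beta>\<^sub>4\<bar>) * \<kappa>"
      using assms \<kappa>0 by simp
    show "F W \<le> M"
      using gap pos by linarith
    show "F W = M \<longleftrightarrow> W \<in> Cc"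
    proof
      assume "F W = M"
      then have "(1 - \<bar>\<beta>\<^sub>4\<bar>) * \<kappa> = 0" using gap pos by linarith
      with assms \<kappa>c show "W \<in> Cc" by simp
    next
      assume "W \<in> Cc"
      with \<kappa>c bound show "F W = M" by simp
    qed
  qed
  \<comment> \<open>Two facts identify the class of \<open>c\<close> with \<open>Cc\<close> without
    showing that cut distance 0 is an equivalence relation: \<open>Cc\<close> is saturated, and
    graphons equal almost everywhere are related.\<close>
  have closed: "U \<in> Cc \<longleftrightarrow> W \<in> Cc" if "(U, W) \<in> graphon3_rel" for U W
    using that cut_dist3_zero_const[OF _ _ _ c(1), of U W] by (auto simp: graphon3_rel_def Cc_def)
  have related: "(U, W) \<in> graphon3_rel" if "U \<in> graphons3" "W \<in> graphons3" "AE p in unif2. U p = W p" for U W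
    using that cut_dist3_zero_if_AE_eq by (simp add: graphon3_rel_def)
  have class_Cc: "graphon3_rel `` {U} = Cc" if "U \<in> Cc" for U
  proof (intro set_eqI iffI)
    show "W \<in> Cc" if "W \<in> graphon3_rel `` {U}" for W
      using that closed \<open>U \<in> Cc\<close> by blast
    show "W \<in> graphon3_rel `` {U}" if W: "W \<in> Cc" for W
    proof -
      have UW: "U \<in> graphons3" "W \<in> graphons3" "AE p in unif2. U p = c" "AE p in unif2. W p = c"
        using W \<open>U \<in> Cc\<close> by (simp_all add: Cc_def)
      have "AE p in unif2. U p = W p"
        using UW(3,4) by eventually_elim simp
      with UW show ?thesis by (simp add: related)
    qed
  qed
  have class_value: "objective \<beta> \<beta>\<^sub>4 C \<le> M" "objective \<beta> \<beta>\<^sub>4 C = M \<longleftrightarrow> C = Cc"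
    if C: "C \<in> graphon3_classes" for C
  proof -
    obtain U where U: "U \<in> graphons3" "C = graphon3_rel `` {U}"
      using C by (auto simp: graphon3_classes_def elim!: quotientE)
    \<comment> \<open>The value on a class is taken at a chosen representative, which may differ
      from \<open>U\<close>. Since the two are related, they lie in \<open>Cc\<close> together or
      not at all, and that decides whether \<open>M\<close> is attained.\<close>
    define V where "V = (SOME W. W \<in> C)"
    have "U \<in> C" using U related[of U U] by simp
    then have V: "V \<in> C" unfolding V_def by (rule someI[of "\<lambda>W. W \<in> C"])
    then have UV: "(U, V) \<in> graphon3_rel" using U by simp
    then have Vg: "V \<in> graphons3" by (simp add: graphon3_rel_def)
    have obj: "objective \<beta> \<beta>\<^sub>4 C = F V"
      by (simp add: objective_def on_class_def F_def V_def)
    show "objective \<beta> \<beta>\<^sub>4 C \<le> M"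
      using F(1)[OF Vg] by (simp add: obj)
    have "V \<in> Cc \<longleftrightarrow> C = Cc"
      using closed[OF UV] class_Cc[of U] U(2) V by blast
    then show "objective \<beta> \<beta>\<^sub>4 C = M \<longleftrightarrow> C = Cc"
      using F(2)[OF Vg] by (simp add: obj)
  qed
  have const: "(\<lambda>_. c) \<in> Cc"
    using c(1) by (simp add: Cc_def graphons3_def)
  have Cc: "Cc \<in> graphon3_classes"
    using quotientI[of "\<lambda>_. c" graphons3 graphon3_rel] const class_Cc[OF const]
    by (simp add: graphon3_classes_def Cc_def)
  have max: "is_maximizer \<beta> \<beta>\<^sub>4 C \<longleftrightarrow> C = Cc" for C
  proof
    assume "is_maximizer \<beta> \<beta>\<^sub>4 C"
    then have C: "C \<in> graphon3_classes" and "\<not> objective \<beta> \<beta>\<^sub>4 C < objective \<beta> \<beta>\<^sub>4 Cc"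
      using Cc by (auto simp: is_maximizer_def is_arg_max_def)
    then have "objective \<beta> \<beta>\<^sub>4 C = M"
      using class_value(1)[OF C] class_value(2)[OF Cc] by simp
    then show "C = Cc" using class_value(2)[OF C] by simp
  next
    assume "C = Cc"
    then show "is_maximizer \<beta> \<beta>\<^sub>4 C"
      using Cc class_value(1) class_value(2)[OF Cc] by (simp add: is_maximizer_def is_arg_max_def not_less)
  qed
  have "constant_graphon3 W" if "W \<in> Cc" for W
    using that c(1) unfolding constant_graphon3_def AE_square_iff Cc_def by blast
  with max show ?thesis by auto
qed

end
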